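(* Let $R$ be the Kazhdan-Lusztig semiring of $S_3$, i.e. the $\mathbb{Z}_{\geq 0}$-span of the Kazhdan-Lusztig basis $\{\underline{w}:w\in S_3\}$ in $\mathbb{Z}[S_3]$. Then, up to isomorphism, the $R$-semimodules $M_1$, $M_2$, $M_3$, $M_4$, $M_5$ and $M_6$ (defined in the context) are the only minimal proper $R$-semimodules.
   Context: A semiring is a tuple $(R,+,\cdot,0,1)$ where $(R,+,0)$ is a commutative monoid, $(R,\cdot,1)$ is a monoid, multiplication distributes over addition on both sides, and $0a=a0=0$ for all $a\in R$. A (left) $R$-semimodule is a commutative monoid $(M,+,0_M)$ with a map $R\times M\to M$, $(r,m)\mapsto r(m)$, such that $r(m+n)=r(m)+r(n)$, $r(0_M)=0_M$, $(r+s)(m)=r(m)+s(m)$, $(rs)(m)=r(s(m))$, $0(m)=0_M$, $1(m)=m$. It is called an $R$-module if $M$ is an abelian group, and a proper semimodule if it is not a module. A subsemimodule is a submonoid closed under the action of $R$. An $R$-congruence on $M$ is an equivalence relation $\sim$ such that $m\sim n$ implies $m+k\sim n+k$ for all $k\in M$ and $r(m)\sim r(n)$ for all $r\in R$; the quotient $M/\sim$ is then naturally an $R$-semimodule. A non-zero $R$-semimodule $M$ is called minimal if its only subsemimodules are $\{0_M\}$ and $M$. Let $s=(1,2)$, $t=(2,3)$ in $S_3=\{e,s,t,st,ts,w_0=sts=tst\}$. The Kazhdan-Lusztig basis of $\mathbb{Z}[S_3]$ is $\underline{e}=e$, $\underline{s}=e+s$, $\underline{t}=e+t$, $\underline{st}=e+s+t+st$,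 $\underline{ts}=e+s+t+ts$, $\underline{w_0}=e+s+t+st+ts+w_0$. Its structure constants are non-negative integers, so $R$ (the set of all $\mathbb{Z}_{\geq 0}$-linear combinations of these elements) is a subsemiring of $\mathbb{Z}[S_3]$. Let $\mathbf{B}$ denote the commutative monoid $(\{0,1\},+,0)$ with $1+1=1$. Define: - $M_1$: underlying monoid $\mathbf{B}$, all $\underline{w}$, $w\in S_3$, act as the identity. - $M_2$: underlying monoid $\mathbf{B}$, $\underline{e}$ acts as the identity and all $\underline{w}$ with $w\neq e$ act as zero. - $M_3$: underlying monoid $\mathbf{B}$, all $\underline{w}$ with $w\neq w_0$ act as the identity and $\underline{w_0}$ acts as zero. - $M_4$: underlying monoid $\mathbf{B}\oplus\mathbf{B}$ (componentwise addition); $\underline{e}$ acts as the identity; $\underline{w_0}$ acts as zero; $\underline{s}$ and $\underline{st}$ send all non-zero elements to $(1,0)$; $\underline{t}$ and $\underline{ts}$ send all non-zero elements to $(0,1)$. - $M_5$: the quotient of $M_4$ by the $R$-congruence which identifies $(1,0)$ and $(1,1)$. - $M_6$: the quotient of $M_4$ by the $R$-congruence which identifies $(0,1)$ and $(1,1)$. *)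

theory Defs
  imports "HOL-Algebra.Sym_Groups" "HOL-Algebra.Module"
begin

section \<open>Semimodules over a semiring\<close>

locale semimodule = R?: semiring R + M?: abelian_monoid M
  for R (structure) and M :: "('a, 'b, 'c) module_scheme" (structure) +
  assumes smult_closed [simp, intro]:
      "\<lbrakk>r \<in> carrier R; m \<in> carrier M\<rbrakk> \<Longrightarrow> r \<odot>\<^bsub>M\<^esub> m \<in> carrier M"
    and smult_add:
      "\<lbrakk>r \<in> carrier R; m \<in> carrier M; n \<in> carrier M\<rbrakk>
        \<Longrightarrow> r \<odot>\<^bsub>M\<^esub> (m \<oplus>\<^bsub>M\<^esub> n) = r \<odot>\<^bsub>M\<^esub> m \<oplus>\<^bsub>M\<^esub> r \<odot>\<^bsub>M\<^esub> n"
    and smult_zero: "r \<in> carrier R \<Longrightarrow> r \<odot>\<^bsub>M\<^esub> \<zero>\<^bsub>M\<^esub> = \<zero>\<^bsub>M\<^esub>"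
    and add_smult:
      "\<lbrakk>r \<in> carrier R; s \<in> carrier R; m \<in> carrier M\<rbrakk>
        \<Longrightarrow> (r \<oplus>\<^bsub>R\<^esub> s) \<odot>\<^bsub>M\<^esub> m = r \<odot>\<^bsub>M\<^esub> m \<oplus>\<^bsub>M\<^esub> s \<odot>\<^bsub>M\<^esub> m"
    and mult_smult:
      "\<lbrakk>r \<in> carrier R; s \<in> carrier R; m \<in> carrier M\<rbrakk>
        \<Longrightarrow> (r \<otimes>\<^bsub>R\<^esub> s) \<odot>\<^bsub>M\<^esub> m = r \<odot>\<^bsub>M\<^esub> (s \<odot>\<^bsub>M\<^esub> m)"
    and zero_smult: "m \<in> carrier M \<Longrightarrow> \<zero>\<^bsub>R\<^esub> \<odot>\<^bsub>M\<^esub> m = \<zero>\<^bsub>M\<^esub>"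
    and one_smult: "m \<in> carrier M \<Longrightarrow> \<one>\<^bsub>R\<^esub> \<odot>\<^bsub>M\<^esub> m = m"

definition proper_semimodule ::
    "('a, 'r) ring_scheme \<Rightarrow> ('a, 'b, 'c) module_scheme \<Rightarrow> bool" where
  "proper_semimodule R M \<longleftrightarrow> semimodule R M \<and> \<not> abelian_group M"

locale subsemimodule = submonoid H "add_monoid M"
  for H and R :: "('a, 'r) ring_scheme" and M :: "('a, 'b, 'c) module_scheme" (structure) +
  assumes smult_closed: "\<lbrakk>r \<in> carrier R; m \<in> H\<rbrakk> \<Longrightarrow> r \<odot>\<^bsub>M\<^esub> m \<in> H"

definition minimal_semimodule ::
    "('a, 'r) ring_scheme \<Rightarrow> ('a, 'b, 'c) module_scheme \<Rightarrow> bool" where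
  "minimal_semimodule R M \<longleftrightarrow>
     semimodule R M \<and> carrier M \<noteq> {\<zero>\<^bsub>M\<^esub>} \<and>
     (\<forall>H. subsemimodule H R M \<longrightarrow> H = {\<zero>\<^bsub>M\<^esub>} \<or> H = carrier M)"

abbreviation minimal_proper ::
    "('a, 'r) ring_scheme \<Rightarrow> ('a, 'b, 'c) module_scheme \<Rightarrow> bool" where
  "minimal_proper R M \<equiv> minimal_semimodule R M \<and> proper_semimodule R M"

definition semimodule_cong ::
    "('a, 'r) ring_scheme \<Rightarrow> ('a, 'b, 'c) module_scheme \<Rightarrow> ('b \<times> 'b) set \<Rightarrow> bool" where
  "semimodule_cong R M \<theta> \<longleftrightarrow>
     equiv (carrier M) \<theta> \<and>
     (\<forall>(m, n) \<in> \<theta>. (\<forall>k \<in> carrier M. (m \<oplus>\<^bsub>M\<^esub> k, n \<oplus>\<^bsub>M\<^esub> k) \<in> \<theta>) \<and>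
                   (\<forall>r \<in> carrier R. (r \<odot>\<^bsub>M\<^esub> m, r \<odot>\<^bsub>M\<^esub> n) \<in> \<theta>))"

text \<open>The congruence identifying two elements \<open>a\<close> and \<open>b\<close> is the least congruence
  relating them.\<close>

definition cong_identifying ::
    "('a, 'r) ring_scheme \<Rightarrow> ('a, 'b, 'c) module_scheme \<Rightarrow> 'b \<Rightarrow> 'b \<Rightarrow> ('b \<times> 'b) set" where
  "cong_identifying R M a b = \<Inter>{\<theta>. semimodule_cong R M \<theta> \<and> (a, b) \<in> \<theta>}"

text \<open>The record type \<open>module\<close> extends rings; its fields \<open>mult\<close> and \<open>one\<close> play no role
  for semimodules and are left unspecified below.\<close>

definition quot_semimodule ::
    "('a, 'b, 'c) module_scheme \<Rightarrow> ('b \<times> 'b) set \<Rightarrow> ('a, 'b set) module" where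
  "quot_semimodule M \<theta> =
     \<lparr>carrier = carrier M // \<theta>, mult = undefined, one = undefined,
      zero = \<theta> `` {\<zero>\<^bsub>M\<^esub>},
      add = (\<lambda>X Y. \<Union>x \<in> X. \<Union>y \<in> Y. \<theta> `` {x \<oplus>\<^bsub>M\<^esub> y}),
      smult = (\<lambda>r X. \<Union>x \<in> X. \<theta> `` {r \<odot>\<^bsub>M\<^esub> x})\<rparr>"

definition semimodule_hom ::
    "('a, 'r) ring_scheme \<Rightarrow> ('a, 'b, 'c) module_scheme \<Rightarrow> ('a, 'd, 'e) module_scheme
      \<Rightarrow> ('b \<Rightarrow> 'd) set" where
  "semimodule_hom R M N =
     {h. h \<in> hom (add_monoid M) (add_monoid N) \<and> h \<zero>\<^bsub>M\<^esub> = \<zero>\<^bsub>N\<^esub> \<and>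
         (\<forall>r \<in> carrier R. \<forall>m \<in> carrier M. h (r \<odot>\<^bsub>M\<^esub> m) = r \<odot>\<^bsub>N\<^esub> h m)}"

definition semimodule_iso ::
    "('a, 'r) ring_scheme \<Rightarrow> ('a, 'b, 'c) module_scheme \<Rightarrow> ('a, 'd, 'e) module_scheme
      \<Rightarrow> bool" where
  "semimodule_iso R M N \<longleftrightarrow>
     (\<exists>h \<in> semimodule_hom R M N. bij_betw h (carrier M) (carrier N))"


section \<open>The Kazhdan-Lusztig semiring of the symmetric group of degree 3\<close>

text \<open>Elements of the integral group ring are the finitely supported functions on the
  group, extended by 0 outside its carrier.\<close>

definition int_group_ring :: "('g, 'x) monoid_scheme \<Rightarrow> ('g \<Rightarrow> int) ring" where
  "int_group_ring G =
     \<lparr>carrier = {f. finite {x. f x \<noteq> 0} \<and> {x. f x \<noteq> 0} \<subseteq> carrier G},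
      mult = (\<lambda>f g z. \<Sum>(x, y) | f x \<noteq> 0 \<and> g y \<noteq> 0 \<and> x \<otimes>\<^bsub>G\<^esub> y = z. f x * g y),
      one = (\<lambda>z. if z = \<one>\<^bsub>G\<^esub> then 1 else 0),
      zero = (\<lambda>z. 0),
      add = (\<lambda>f g z. f z + g z)\<rparr>"

abbreviation S3 :: "(nat \<Rightarrow> nat) monoid" where
  "S3 \<equiv> sym_group 3"

definition refl_s :: "nat \<Rightarrow> nat" where "refl_s = Transposition.transpose 1 2"
definition refl_t :: "nat \<Rightarrow> nat" where "refl_t = Transposition.transpose 2 3"
definition longest_w0 :: "nat \<Rightarrow> nat" where "longest_w0 = refl_s \<circ> refl_t \<circ> refl_s"

text \<open>In degree 3 each Kazhdan-Lusztig basis element is a sum of distinct group elements;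
  \<open>KL_support w\<close> is the set of its summands. The last case is
  \<open>w = longest_w0\<close>; other functions \<open>w\<close> never matter.\<close>

definition KL_support :: "(nat \<Rightarrow> nat) \<Rightarrow> (nat \<Rightarrow> nat) set" where
  "KL_support w =
     (if w = id then {id}
      else if w = refl_s then {id, refl_s}
      else if w = refl_t then {id, refl_t}
      else if w = refl_s \<circ> refl_t then {id, refl_s, refl_t, refl_s \<circ> refl_t}
      else if w = refl_t \<circ> refl_s then {id, refl_s, refl_t, refl_t \<circ> refl_s}
      else {id, refl_s, refl_t, refl_s \<circ> refl_t, refl_t \<circ> refl_s, longest_w0})"

definition KL_basis :: "(nat \<Rightarrow> nat) \<Rightarrow> (nat \<Rightarrow> nat) \<Rightarrow> int" where
  "KL_basis w = (\<lambda>x. if x \<in> KL_support w then 1 else 0)"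

definition KL_comb :: "((nat \<Rightarrow> nat) \<Rightarrow> nat) \<Rightarrow> (nat \<Rightarrow> nat) \<Rightarrow> int" where
  "KL_comb c = (\<lambda>x. \<Sum>w \<in> carrier S3. int (c w) * KL_basis w x)"

definition KL_semiring :: "((nat \<Rightarrow> nat) \<Rightarrow> int) ring" where
  "KL_semiring = (int_group_ring S3)\<lparr>carrier := range KL_comb\<rparr>"

abbreviation KL_iso ::
    "((nat \<Rightarrow> nat) \<Rightarrow> int, 'b, 'c) module_scheme
      \<Rightarrow> ((nat \<Rightarrow> nat) \<Rightarrow> int, 'd, 'e) module_scheme \<Rightarrow> bool" where
  "KL_iso \<equiv> semimodule_iso KL_semiring"

text \<open>The coefficients of an element of the semiring in the Kazhdan-Lusztig basis; they are
  unique once normalised to 0 outside the group.\<close>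

definition KL_coeff :: "((nat \<Rightarrow> nat) \<Rightarrow> int) \<Rightarrow> (nat \<Rightarrow> nat) \<Rightarrow> nat" where
  "KL_coeff r = (THE c. (\<forall>w. w \<notin> carrier S3 \<longrightarrow> c w = 0) \<and> KL_comb c = r)"

text \<open>Given a commutative monoid \<open>A\<close> (in the multiplicative notation of the library, but to be
  read additively) and, for each \<open>w\<close>, a map \<open>act w\<close> giving the action of \<open>KL_basis w\<close>,
  this is \<open>A\<close> with the action extended to the semiring additively: the sum over \<open>w\<close> of
  \<open>KL_coeff r w\<close> copies of \<open>act w m\<close>.\<close>

definition KL_semimodule ::
    "'m monoid \<Rightarrow> ((nat \<Rightarrow> nat) \<Rightarrow> 'm \<Rightarrow> 'm) \<Rightarrow> ((nat \<Rightarrow> nat) \<Rightarrow> int, 'm) module" where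
  "KL_semimodule A act =
     \<lparr>carrier = carrier A, mult = undefined, one = undefined,
      zero = \<one>\<^bsub>A\<^esub>, add = (\<otimes>\<^bsub>A\<^esub>),
      smult = (\<lambda>r m. \<Otimes>\<^bsub>A\<^esub>w \<in> carrier S3. act w m [^]\<^bsub>A\<^esub> KL_coeff r w)\<rparr>"

text \<open>The monoid with elements 0, 1 and 1 + 1 = 1, realised on \<open>bool\<close>.\<close>

definition Bmon :: "bool monoid" where
  "Bmon = \<lparr>carrier = UNIV, mult = (\<or>), one = False\<rparr>"

definition M1 :: "((nat \<Rightarrow> nat) \<Rightarrow> int, bool) module" where
  "M1 = KL_semimodule Bmon (\<lambda>w m. m)"

definition M2 :: "((nat \<Rightarrow> nat) \<Rightarrow> int, bool) module" where
  "M2 = KL_semimodule Bmon (\<lambda>w m. if w = id then m else False)"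

definition M3 :: "((nat \<Rightarrow> nat) \<Rightarrow> int, bool) module" where
  "M3 = KL_semimodule Bmon (\<lambda>w m. if w = longest_w0 then False else m)"

definition M4 :: "((nat \<Rightarrow> nat) \<Rightarrow> int, bool \<times> bool) module" where
  "M4 = KL_semimodule (Bmon \<times>\<times> Bmon)
     (\<lambda>w m. if w = id then m
            else if w = longest_w0 \<or> m = (False, False) then (False, False)
            else if w = refl_s \<or> w = refl_s \<circ> refl_t then (True, False)
            else (False, True))"

definition M5 :: "((nat \<Rightarrow> nat) \<Rightarrow> int, (bool \<times> bool) set) module" where
  "M5 = quot_semimodule M4 (cong_identifying KL_semiring M4 (True, False) (True, True))"

definition M6 :: "((nat \<Rightarrow> nat) \<Rightarrow> int, (bool \<times> bool) set) module" where
  "M6 = quot_semimodule M4 (cong_identifying KL_semiring M4 (False, True) (True, True))"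

end

theory Submission
  imports Defs
begin

text \<open>
  Let \<open>M\<close> be a minimal proper semimodule. Minimality is used through subsemimodules that have to be
  zero or everything. The invertible elements are not everything, so \<open>M\<close> is conical: a sum is zero
  only if both summands are. Every non-zero \<open>x\<close> generates \<open>M\<close>, and every element is of the form
  \<open>z + z\<close>. Finally, one non-zero idempotent \<open>v = v + v\<close> makes all of \<open>M\<close> idempotent.

  Such an idempotent always exists here. The action of \<open>M\<close> is controlled by very few elements: either
  a single \<open>x\<close> such that every non-zero element of \<open>M\<close> has the form \<open>x + u\<close>, or a pair \<open>a, b\<close> such
  that every non-zero element has the form \<open>a + u\<close> or \<open>b + u\<close>. In the first case, halving \<open>x = z + z\<close>
  gives \<open>z = x + u = z + z + u\<close>, and then \<open>z + u\<close> is idempotent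
  (\<open>idempotent_if_absorbed_by_half\<close>). In the second case the action of \<open>KL_t\<close>, which sends \<open>a\<close>
  to \<open>b\<close>, leads back to the same situation.

  Idempotency leaves at most the elements \<open>0, a, b, a + b\<close>, and the multiplication table determines
  the action. If \<open>KL_w0\<close> acts non-trivially, the result is \<open>M1\<close> (\<open>classify_w0_nonzero\<close>). If
  \<open>KL_w0\<close> acts as zero, then \<open>sts = s\<close> and \<open>tst = t\<close> on \<open>M\<close>, so \<open>KL_s\<close> and \<open>KL_t\<close> vanish together;
  if they do, only the unit acts and the result is \<open>M2\<close> (\<open>classify_s_zero\<close>). Otherwise
  \<open>a = s m \<noteq> 0\<close> and \<open>b = t a\<close> satisfy \<open>s b = a\<close>, and \<open>M\<close> is a quotient
  of \<open>M4\<close>: it is \<open>M3\<close>, \<open>M4\<close>, \<open>M5\<close> or \<open>M6\<close> according to the coincidences among \<open>a\<close>, \<open>b\<close> and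
  \<open>a + b\<close> (\<open>classify_s_nonzero\<close>).

  Conversely, each of \<open>M1\<close> to \<open>M4\<close> is defined by prescribing the action of the six basis elements. That
  this extends to an action of the semiring is a check of the multiplication table, carried out once
  for all idempotent monoids in the locale \<open>idempotent_KL_action\<close>. Minimality and properness pass to the
  quotients \<open>M5\<close> and \<open>M6\<close>. The six are distinguished by which of the equations \<open>w0 m = 0\<close>,
  \<open>s m = 0\<close>, \<open>s m = m\<close>, \<open>s m + m = s m\<close> and \<open>t m + m = t m\<close> hold identically in them.
\<close>

section \<open>The integral group ring of a finite group\<close>

lemma int_group_ring_simps:
  "carrier (int_group_ring G) = {f. finite {x. f x \<noteq> 0} \<and> {x. f x \<noteq> 0} \<subseteq> carrier G}"
  "\<zero>\<^bsub>int_group_ring G\<^esub> = (\<lambda>z. 0)"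
  "\<one>\<^bsub>int_group_ring G\<^esub> = (\<lambda>z. if z = \<one>\<^bsub>G\<^esub> then 1 else 0)"
  "f \<oplus>\<^bsub>int_group_ring G\<^esub> g = (\<lambda>z. f z + g z)"
  by (simp_all add: int_group_ring_def)

lemma int_group_ring_outside:
  "f \<in> carrier (int_group_ring G) \<Longrightarrow> z \<notin> carrier G \<Longrightarrow> f z = 0"
  by (auto simp: int_group_ring_simps)

lemma int_group_ring_mult_outside:
  assumes "group G" "f \<in> carrier (int_group_ring G)" "g \<in> carrier (int_group_ring G)"
    and "z \<notin> carrier G"
  shows "(f \<otimes>\<^bsub>int_group_ring G\<^esub> g) z = 0"
proof -
  interpret group G by fact
  have "{(x, y). f x \<noteq> 0 \<and> g y \<noteq> 0 \<and> x \<otimes>\<^bsub>G\<^esub> y = z} = {}"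
    using assms(2-4) by (auto simp: int_group_ring_simps)
  then show ?thesis
    by (simp add: int_group_ring_def del: Collect_empty_eq)
qed

text \<open>Solving \<open>x y = z\<close> for \<open>y\<close> turns the sum over pairs of support elements into a convolution over a
  fixed index set. Only in this form can the sums be swapped and reindexed, which is how
  associativity is proved below.\<close>

lemma int_group_ring_mult_conv:
  assumes "group G" "finite (carrier G)"
    and f: "f \<in> carrier (int_group_ring G)" and g: "g \<in> carrier (int_group_ring G)"
    and z: "z \<in> carrier G"
  shows "(f \<otimes>\<^bsub>int_group_ring G\<^esub> g) z = (\<Sum>x\<in>carrier G. f x * g (inv\<^bsub>G\<^esub> x \<otimes>\<^bsub>G\<^esub> z))"
proof -
  interpret group G by fact
  let ?X = "{x \<in> carrier G. f x \<noteq> 0 \<and> g (inv\<^bsub>G\<^esub> x \<otimes>\<^bsub>G\<^esub> z) \<noteq> 0}"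
  have fc: "f x \<noteq> 0 \<Longrightarrow> x \<in> carrier G" and gc: "g x \<noteq> 0 \<Longrightarrow> x \<in> carrier G" for x
    using int_group_ring_outside[OF f] int_group_ring_outside[OF g] by blast+
  have "{(x, y). f x \<noteq> 0 \<and> g y \<noteq> 0 \<and> x \<otimes>\<^bsub>G\<^esub> y = z} = (\<lambda>x. (x, inv\<^bsub>G\<^esub> x \<otimes>\<^bsub>G\<^esub> z)) ` ?X" (is "?P = _")
  proof (intro equalityI subsetI)
    fix p assume "p \<in> ?P"
    then obtain x y where p: "p = (x, y)" "f x \<noteq> 0" "g y \<noteq> 0" "x \<otimes>\<^bsub>G\<^esub> y = z" by blast
    then have "x \<in> carrier G" "y = inv\<^bsub>G\<^esub> x \<otimes>\<^bsub>G\<^esub> z"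
      using fc gc inv_solve_left z by auto
    then show "p \<in> (\<lambda>x. (x, inv\<^bsub>G\<^esub> x \<otimes>\<^bsub>G\<^esub> z)) ` ?X"
      using p by auto
  next
    fix p assume "p \<in> (\<lambda>x. (x, inv\<^bsub>G\<^esub> x \<otimes>\<^bsub>G\<^esub> z)) ` ?X"
    then show "p \<in> ?P" using z by (auto simp: m_assoc[symmetric])
  qed
  moreover have "inj_on (\<lambda>x. (x, inv\<^bsub>G\<^esub> x \<otimes>\<^bsub>G\<^esub> z)) ?X"
    by (auto intro: inj_onI)
  ultimately have "(f \<otimes>\<^bsub>int_group_ring G\<^esub> g) z = (\<Sum>x\<in>?X. f x * g (inv\<^bsub>G\<^esub> x \<otimes>\<^bsub>G\<^esub> z))"
    by (simp add: int_group_ring_def sum.reindex)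
  also have "\<dots> = (\<Sum>x\<in>carrier G. f x * g (inv\<^bsub>G\<^esub> x \<otimes>\<^bsub>G\<^esub> z))"
    using assms(2) by (intro sum.mono_neutral_left) auto
  finally show ?thesis .
qed

lemma int_group_ring_carrier_finite:
  "finite (carrier G) \<Longrightarrow>
     f \<in> carrier (int_group_ring G) \<longleftrightarrow> (\<forall>z. z \<notin> carrier G \<longrightarrow> f z = 0)"
  by (auto simp: int_group_ring_simps intro: finite_subset)

lemma int_group_ring_mult_closed:
  assumes "group G" "finite (carrier G)"
    and "f \<in> carrier (int_group_ring G)" "g \<in> carrier (int_group_ring G)"
  shows "f \<otimes>\<^bsub>int_group_ring G\<^esub> g \<in> carrier (int_group_ring G)"
  using int_group_ring_mult_outside[OF assms(1,3,4)]
  by (simp add: int_group_ring_carrier_finite[OF assms(2)])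

lemma int_group_ring_semiring:
  assumes "group G" "finite (carrier G)"
  shows "semiring (int_group_ring G)"
proof -
  interpret group G by fact
  let ?R = "int_group_ring G"
  note carr = int_group_ring_carrier_finite[OF assms(2)]
  note closed = int_group_ring_mult_closed[OF assms]
  note conv = int_group_ring_mult_conv[OF assms]
  note outside = int_group_ring_mult_outside[OF assms(1)]
  have one: "\<one>\<^bsub>?R\<^esub> \<in> carrier ?R" and zero: "\<zero>\<^bsub>?R\<^esub> \<in> carrier ?R"
    and add: "\<And>f g. f \<in> carrier ?R \<Longrightarrow> g \<in> carrier ?R \<Longrightarrow> f \<oplus>\<^bsub>?R\<^esub> g \<in> carrier ?R"
    by (auto simp: carr int_group_ring_simps(2-))
  have ext: "u = v" if "u \<in> carrier ?R" "v \<in> carrier ?R" "\<And>z. z \<in> carrier G \<Longrightarrow> u z = v z" for u v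
  proof
    fix z show "u z = v z"
      using that by (cases "z \<in> carrier G") (simp_all add: carr)
  qed
  show ?thesis
  proof (rule semiring.intro)
    show "abelian_monoid ?R"
      by (rule abelian_monoidI) (use zero add in \<open>simp_all add: int_group_ring_simps(2,4) fun_eq_iff\<close>)
    show "Group.monoid ?R"
    proof (rule monoidI)
      fix f g h assume fgh: "f \<in> carrier ?R" "g \<in> carrier ?R" "h \<in> carrier ?R"
      show "f \<otimes>\<^bsub>?R\<^esub> g \<otimes>\<^bsub>?R\<^esub> h = f \<otimes>\<^bsub>?R\<^esub> (g \<otimes>\<^bsub>?R\<^esub> h)"
      proof (rule ext)
        fix z assume z: "z \<in> carrier G"
        have "(f \<otimes>\<^bsub>?R\<^esub> g \<otimes>\<^bsub>?R\<^esub> h) z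
            = (\<Sum>u\<in>carrier G. \<Sum>x\<in>carrier G. f x * g (inv\<^bsub>G\<^esub> x \<otimes>\<^bsub>G\<^esub> u) * h (inv\<^bsub>G\<^esub> u \<otimes>\<^bsub>G\<^esub> z))"
          using fgh z closed by (simp add: conv sum_distrib_right)
        also have "\<dots> = (\<Sum>x\<in>carrier G. \<Sum>u\<in>carrier G. f x * g (inv\<^bsub>G\<^esub> x \<otimes>\<^bsub>G\<^esub> u) * h (inv\<^bsub>G\<^esub> u \<otimes>\<^bsub>G\<^esub> z))"
          by (rule sum.swap)
        also have "\<dots> = (\<Sum>x\<in>carrier G. \<Sum>y\<in>carrier G. f x * (g y * h (inv\<^bsub>G\<^esub> y \<otimes>\<^bsub>G\<^esub> (inv\<^bsub>G\<^esub> x \<otimes>\<^bsub>G\<^esub> z))))"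
        proof (rule sum.cong[OF refl])
          fix x assume x: "x \<in> carrier G"
          have cancel: "x \<otimes>\<^bsub>G\<^esub> (inv\<^bsub>G\<^esub> x \<otimes>\<^bsub>G\<^esub> v) = v" "inv\<^bsub>G\<^esub> x \<otimes>\<^bsub>G\<^esub> (x \<otimes>\<^bsub>G\<^esub> v) = v"
            if "v \<in> carrier G" for v
            using x that by (simp_all add: m_assoc[symmetric])
          show "(\<Sum>u\<in>carrier G. f x * g (inv\<^bsub>G\<^esub> x \<otimes>\<^bsub>G\<^esub> u) * h (inv\<^bsub>G\<^esub> u \<otimes>\<^bsub>G\<^esub> z))
            = (\<Sum>y\<in>carrier G. f x * (g y * h (inv\<^bsub>G\<^esub> y \<otimes>\<^bsub>G\<^esub> (inv\<^bsub>G\<^esub> x \<otimes>\<^bsub>G\<^esub> z))))"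
            by (rule sum.reindex_bij_witness[where i="\<lambda>y. x \<otimes>\<^bsub>G\<^esub> y" and j="\<lambda>u. inv\<^bsub>G\<^esub> x \<otimes>\<^bsub>G\<^esub> u"])
              (use x z in \<open>simp_all add: m_assoc inv_mult_group cancel\<close>)
        qed
        also have "\<dots> = (f \<otimes>\<^bsub>?R\<^esub> (g \<otimes>\<^bsub>?R\<^esub> h)) z"
          using fgh z closed by (simp add: conv sum_distrib_left)
        finally show "(f \<otimes>\<^bsub>?R\<^esub> g \<otimes>\<^bsub>?R\<^esub> h) z = (f \<otimes>\<^bsub>?R\<^esub> (g \<otimes>\<^bsub>?R\<^esub> h)) z" .
      qed (auto intro: closed fgh)
    next
      fix f assume f: "f \<in> carrier ?R"
      show "\<one>\<^bsub>?R\<^esub> \<otimes>\<^bsub>?R\<^esub> f = f"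
      proof (rule ext)
        fix z assume z: "z \<in> carrier G"
        have "(\<one>\<^bsub>?R\<^esub> \<otimes>\<^bsub>?R\<^esub> f) z = (\<Sum>x\<in>carrier G. if x = \<one>\<^bsub>G\<^esub> then f z else 0)"
          using z one f by (auto simp: conv int_group_ring_simps(3) intro!: sum.cong)
        then show "(\<one>\<^bsub>?R\<^esub> \<otimes>\<^bsub>?R\<^esub> f) z = f z"
          using assms(2) by simp
      qed (auto intro: closed one f)
      show "f \<otimes>\<^bsub>?R\<^esub> \<one>\<^bsub>?R\<^esub> = f"
      proof (rule ext)
        fix z assume z: "z \<in> carrier G"
        have "inv\<^bsub>G\<^esub> x \<otimes>\<^bsub>G\<^esub> z = \<one>\<^bsub>G\<^esub> \<longleftrightarrow> x = z" if "x \<in> carrier G" for x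
          using that z inv_solve_left[of "\<one>\<^bsub>G\<^esub>" x z] by auto
        then have "(f \<otimes>\<^bsub>?R\<^esub> \<one>\<^bsub>?R\<^esub>) z = (\<Sum>x\<in>carrier G. if x = z then f z else 0)"
          using z one f by (auto simp: conv int_group_ring_simps(3) intro!: sum.cong)
        then show "(f \<otimes>\<^bsub>?R\<^esub> \<one>\<^bsub>?R\<^esub>) z = f z"
          using assms(2) z by simp
      qed (auto intro: closed one f)
    qed (auto intro: closed one)
    show "semiring_axioms ?R"
    proof
      fix f g h assume fgh: "f \<in> carrier ?R" "g \<in> carrier ?R" "h \<in> carrier ?R"
      have apply_add: "(u \<oplus>\<^bsub>?R\<^esub> v) z = u z + v z" for u v z
        by (simp add: int_group_ring_simps(4))
      show "(f \<oplus>\<^bsub>?R\<^esub> g) \<otimes>\<^bsub>?R\<^esub> h = f \<otimes>\<^bsub>?R\<^esub> h \<oplus>\<^bsub>?R\<^esub> g \<otimes>\<^bsub>?R\<^esub> h"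
        by (rule ext) (simp_all add: closed add fgh conv apply_add sum.distrib distrib_right)
      show "h \<otimes>\<^bsub>?R\<^esub> (f \<oplus>\<^bsub>?R\<^esub> g) = h \<otimes>\<^bsub>?R\<^esub> f \<oplus>\<^bsub>?R\<^esub> h \<otimes>\<^bsub>?R\<^esub> g"
        by (rule ext) (simp_all add: closed add fgh conv apply_add sum.distrib distrib_left)
    next
      fix f assume f: "f \<in> carrier ?R"
      have zero_apply: "\<zero>\<^bsub>?R\<^esub> z = 0" for z
        by (simp add: int_group_ring_simps(2))
      show "\<zero>\<^bsub>?R\<^esub> \<otimes>\<^bsub>?R\<^esub> f = \<zero>\<^bsub>?R\<^esub>" "f \<otimes>\<^bsub>?R\<^esub> \<zero>\<^bsub>?R\<^esub> = \<zero>\<^bsub>?R\<^esub>"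
        by (rule ext; simp add: closed zero f conv zero_apply)+
    qed
  qed
qed

lemma (in semiring) subsemiring:
  assumes "H \<subseteq> carrier R" "\<zero> \<in> H" "\<one> \<in> H"
    and "\<And>x y. x \<in> H \<Longrightarrow> y \<in> H \<Longrightarrow> x \<oplus> y \<in> H"
    and "\<And>x y. x \<in> H \<Longrightarrow> y \<in> H \<Longrightarrow> x \<otimes> y \<in> H"
  shows "semiring (R\<lparr>carrier := H\<rparr>)"
proof -
  have H: "x \<in> carrier R" if "x \<in> H" for x
    using assms(1) that by blast
  show ?thesis
  proof (rule semiring.intro)
    show "abelian_monoid (R\<lparr>carrier := H\<rparr>)"
      by (rule abelian_monoidI) (simp_all add: assms H a_ac)
    show "Group.monoid (R\<lparr>carrier := H\<rparr>)"
      by (rule monoidI) (simp_all add: assms H m_assoc)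
    show "semiring_axioms (R\<lparr>carrier := H\<rparr>)"
      by standard (simp_all add: assms H l_distr r_distr)
  qed
qed

section \<open>The symmetric group of degree 3\<close>

text \<open>A permutation of \<open>{1, 2, 3}\<close> is determined by its values there, so comparing six triples
  suffices.\<close>

lemma S3_distinct:
  "distinct [id, refl_s, refl_t, refl_s \<circ> refl_t, refl_t \<circ> refl_s, longest_w0]"
proof -
  let ?p = "\<lambda>w :: nat \<Rightarrow> nat. (w 1, w 2, w 3)"
  have "distinct (map ?p [id, refl_s, refl_t, refl_s \<circ> refl_t, refl_t \<circ> refl_s, longest_w0])"
    by (simp add: refl_s_def refl_t_def longest_w0_def Transposition.transpose_def)
  then show ?thesis by (rule distinct_map[THEN iffD1, THEN conjunct1])
qed

lemma S3_neq [simp]: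
  "id \<noteq> refl_s" "refl_s \<noteq> id" "id \<noteq> refl_t" "refl_t \<noteq> id"
  "id \<noteq> refl_s \<circ> refl_t" "refl_s \<circ> refl_t \<noteq> id"
  "id \<noteq> refl_t \<circ> refl_s" "refl_t \<circ> refl_s \<noteq> id"
  "id \<noteq> longest_w0" "longest_w0 \<noteq> id"
  "refl_s \<noteq> refl_t" "refl_t \<noteq> refl_s"
  "refl_s \<noteq> refl_s \<circ> refl_t" "refl_s \<circ> refl_t \<noteq> refl_s"
  "refl_s \<noteq> refl_t \<circ> refl_s" "refl_t \<circ> refl_s \<noteq> refl_s"
  "refl_s \<noteq> longest_w0" "longest_w0 \<noteq> refl_s"
  "refl_t \<noteq> refl_s \<circ> refl_t" "refl_s \<circ> refl_t \<noteq> refl_t"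
  "refl_t \<noteq> refl_t \<circ> refl_s" "refl_t \<circ> refl_s \<noteq> refl_t"
  "refl_t \<noteq> longest_w0" "longest_w0 \<noteq> refl_t"
  "refl_s \<circ> refl_t \<noteq> refl_t \<circ> refl_s" "refl_t \<circ> refl_s \<noteq> refl_s \<circ> refl_t"
  "refl_s \<circ> refl_t \<noteq> longest_w0" "longest_w0 \<noteq> refl_s \<circ> refl_t"
  "refl_t \<circ> refl_s \<noteq> longest_w0" "longest_w0 \<noteq> refl_t \<circ> refl_s"
  using S3_distinct by (simp_all add: eq_commute)


lemma S3_carrier:
  "carrier S3 = {id, refl_s, refl_t, refl_s \<circ> refl_t, refl_t \<circ> refl_s, longest_w0}"
proof -
  let ?W = "{id, refl_s, refl_t, refl_s \<circ> refl_t, refl_t \<circ> refl_s, longest_w0}"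
  have s: "refl_s permutes {1..3}" and t: "refl_t permutes {1..3}"
    by (auto simp: refl_s_def refl_t_def intro!: permutes_swap_id)
  have "?W \<subseteq> carrier S3"
    using s t by (auto simp: sym_group_def longest_w0_def permutes_id intro!: permutes_compose)
  moreover have "card ?W = 6"
    by (simp add: card_insert_if)
  moreover have "card (carrier S3) = 6"
    by (simp add: sym_group_card_carrier fact_numeral)
  moreover have "finite (carrier S3)"
    using calculation by (simp add: card_ge_0_finite)
  ultimately show ?thesis
    by (metis card_subset_eq)
qed

lemma S3_elements [simp]:
  "id \<in> carrier S3" "refl_s \<in> carrier S3" "refl_t \<in> carrier S3"
  "refl_s \<circ> refl_t \<in> carrier S3" "refl_t \<circ> refl_s \<in> carrier S3" "longest_w0 \<in> carrier S3"
  by (simp_all add: S3_carrier)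

lemma S3_finite: "finite (carrier S3)"
  by (simp add: S3_carrier)

lemma S3_group: "group S3"
  by (rule sym_group_is_group)

text \<open>Left multiplication by a reflection maps each of the six normal forms to another one, so these
  rules evaluate every right-nested word in the two reflections.\<close>

lemma S3_generators_mult [simp]:
  "refl_s \<circ> refl_s = id" "refl_t \<circ> refl_t = id"
  "refl_s \<circ> (refl_s \<circ> f) = f" "refl_t \<circ> (refl_t \<circ> f) = f"
  "refl_s \<circ> (refl_t \<circ> refl_s) = longest_w0" "refl_t \<circ> (refl_s \<circ> refl_t) = longest_w0"
  "refl_s \<circ> longest_w0 = refl_t \<circ> refl_s" "refl_t \<circ> longest_w0 = refl_s \<circ> refl_t"
  by (auto simp: refl_s_def refl_t_def longest_w0_def fun_eq_iff Transposition.transpose_def)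

lemma S3_mult: "x \<otimes>\<^bsub>S3\<^esub> y = x \<circ> y" and S3_one: "\<one>\<^bsub>S3\<^esub> = id"
  by (simp_all add: sym_group_def)

lemma S3_inv_generators: "inv\<^bsub>S3\<^esub> id = id" "inv\<^bsub>S3\<^esub> refl_s = refl_s" "inv\<^bsub>S3\<^esub> refl_t = refl_t"
proof -
  interpret group S3 by (rule S3_group)
  show "inv\<^bsub>S3\<^esub> id = id" "inv\<^bsub>S3\<^esub> refl_s = refl_s" "inv\<^bsub>S3\<^esub> refl_t = refl_t"
    by (rule inv_equality; simp add: S3_mult S3_one S3_carrier)+
qed

section \<open>The Kazhdan-Lusztig semiring\<close>

abbreviation ZS3 :: "((nat \<Rightarrow> nat) \<Rightarrow> int) ring" where "ZS3 \<equiv> int_group_ring S3"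
abbreviation "KL_e \<equiv> KL_basis id"
abbreviation "KL_s \<equiv> KL_basis refl_s"
abbreviation "KL_t \<equiv> KL_basis refl_t"
abbreviation "KL_st \<equiv> KL_basis (refl_s \<circ> refl_t)"
abbreviation "KL_ts \<equiv> KL_basis (refl_t \<circ> refl_s)"
abbreviation "KL_w0 \<equiv> KL_basis longest_w0"

lemma (in group) sum_inv_mult:
  assumes "z \<in> carrier G"
  shows "(\<Sum>x\<in>carrier G. f (inv x \<otimes> z)) = (\<Sum>x\<in>carrier G. f x)"
proof -
  have "z \<otimes> (inv z \<otimes> x) = x" if "x \<in> carrier G" for x
    using assms that by (simp add: m_assoc[symmetric])
  with assms show ?thesis
    by (intro sum.reindex_bij_witness[where i="\<lambda>y. z \<otimes> inv y" and j="\<lambda>x. inv x \<otimes> z"])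
      (simp_all add: m_assoc inv_mult_group)
qed

lemma ZS3_carrier: "f \<in> carrier ZS3 \<longleftrightarrow> (\<forall>z. z \<notin> carrier S3 \<longrightarrow> f z = 0)"
  by (rule int_group_ring_carrier_finite[OF S3_finite])

lemma ZS3_eqI:
  assumes "f \<in> carrier ZS3" "g \<in> carrier ZS3"
    and "f id = g id" "f refl_s = g refl_s" "f refl_t = g refl_t"
      "f (refl_s \<circ> refl_t) = g (refl_s \<circ> refl_t)" "f (refl_t \<circ> refl_s) = g (refl_t \<circ> refl_s)"
      "f longest_w0 = g longest_w0"
  shows "f = g"
proof
  fix z show "f z = g z"
    using assms by (cases "z \<in> carrier S3") (auto simp: ZS3_carrier, auto simp: S3_carrier)
qed

interpretation ZS3: semiring ZS3
  by (rule int_group_ring_semiring[OF S3_group S3_finite])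

lemma KL_basis_in_ZS3 [simp]: "w \<in> carrier S3 \<Longrightarrow> KL_basis w \<in> carrier ZS3"
  by (auto simp: ZS3_carrier S3_carrier KL_basis_def KL_support_def)

text \<open>Left multiplication by \<open>e + s\<close> adds to a function its translate by \<open>s\<close>. As \<open>KL_w0\<close> is the sum
  of all group elements, multiplication by it only sees the sum of the coefficients.\<close>

lemma KL_basis_mult_apply:
  assumes f: "f \<in> carrier ZS3" and z: "z \<in> carrier S3"
  shows "(KL_s \<otimes>\<^bsub>ZS3\<^esub> f) z = f z + f (refl_s \<circ> z)"
    and "(KL_t \<otimes>\<^bsub>ZS3\<^esub> f) z = f z + f (refl_t \<circ> z)"
    and "(KL_w0 \<otimes>\<^bsub>ZS3\<^esub> f) z = (\<Sum>x\<in>carrier S3. f x)"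
proof -
  interpret group S3 by (rule S3_group)
  have conv: "(g \<otimes>\<^bsub>ZS3\<^esub> f) z = (\<Sum>x\<in>carrier S3. g x * f (inv\<^bsub>S3\<^esub> x \<otimes>\<^bsub>S3\<^esub> z))"
    if "g \<in> carrier ZS3" for g
    by (rule int_group_ring_mult_conv[OF S3_group S3_finite that f z])
  show "(KL_s \<otimes>\<^bsub>ZS3\<^esub> f) z = f z + f (refl_s \<circ> z)"
    unfolding conv[OF KL_basis_in_ZS3[OF S3_elements(2)]] S3_carrier S3_mult
    by (simp add: S3_inv_generators KL_basis_def KL_support_def del: sym_group_inv_equality)
  show "(KL_t \<otimes>\<^bsub>ZS3\<^esub> f) z = f z + f (refl_t \<circ> z)"
    unfolding conv[OF KL_basis_in_ZS3[OF S3_elements(3)]] S3_carrier S3_mult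
    by (simp add: S3_inv_generators KL_basis_def KL_support_def del: sym_group_inv_equality)
  have "KL_w0 x = 1" if "x \<in> carrier S3" for x
    using that by (auto simp: S3_carrier KL_basis_def KL_support_def)
  then have "(KL_w0 \<otimes>\<^bsub>ZS3\<^esub> f) z = (\<Sum>x\<in>carrier S3. f (inv\<^bsub>S3\<^esub> x \<otimes>\<^bsub>S3\<^esub> z))"
    by (simp add: conv)
  also have "\<dots> = (\<Sum>x\<in>carrier S3. f x)"
    by (rule sum_inv_mult[OF z])
  finally show "(KL_w0 \<otimes>\<^bsub>ZS3\<^esub> f) z = (\<Sum>x\<in>carrier S3. f x)" .
qed

text \<open>Besides the unit, the rows of \<open>KL_s\<close> and \<open>KL_t\<close> are complete and the row of \<open>KL_w0\<close> contains
  its products with the generators and with itself. The remaining products follow by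
  associativity, because \<open>KL_st\<close> and \<open>KL_ts\<close> are products of generators.\<close>

lemma KL_multiplication_table:
  shows "\<one>\<^bsub>ZS3\<^esub> = KL_e"
    and "KL_s \<otimes>\<^bsub>ZS3\<^esub> KL_s = KL_s \<oplus>\<^bsub>ZS3\<^esub> KL_s"
    and "KL_s \<otimes>\<^bsub>ZS3\<^esub> KL_t = KL_st"
    and "KL_s \<otimes>\<^bsub>ZS3\<^esub> KL_st = KL_st \<oplus>\<^bsub>ZS3\<^esub> KL_st"
    and "KL_s \<otimes>\<^bsub>ZS3\<^esub> KL_ts = KL_w0 \<oplus>\<^bsub>ZS3\<^esub> KL_s"
    and "KL_s \<otimes>\<^bsub>ZS3\<^esub> KL_w0 = KL_w0 \<oplus>\<^bsub>ZS3\<^esub> KL_w0"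
    and "KL_t \<otimes>\<^bsub>ZS3\<^esub> KL_s = KL_ts"
    and "KL_t \<otimes>\<^bsub>ZS3\<^esub> KL_t = KL_t \<oplus>\<^bsub>ZS3\<^esub> KL_t"
    and "KL_t \<otimes>\<^bsub>ZS3\<^esub> KL_st = KL_w0 \<oplus>\<^bsub>ZS3\<^esub> KL_t"
    and "KL_t \<otimes>\<^bsub>ZS3\<^esub> KL_ts = KL_ts \<oplus>\<^bsub>ZS3\<^esub> KL_ts"
    and "KL_t \<otimes>\<^bsub>ZS3\<^esub> KL_w0 = KL_w0 \<oplus>\<^bsub>ZS3\<^esub> KL_w0"
    and "KL_w0 \<otimes>\<^bsub>ZS3\<^esub> KL_s = KL_w0 \<oplus>\<^bsub>ZS3\<^esub> KL_w0"
    and "KL_w0 \<otimes>\<^bsub>ZS3\<^esub> KL_t = KL_w0 \<oplus>\<^bsub>ZS3\<^esub> KL_w0"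
    and "KL_w0 \<otimes>\<^bsub>ZS3\<^esub> KL_w0 = KL_w0 \<oplus>\<^bsub>ZS3\<^esub> KL_w0 \<oplus>\<^bsub>ZS3\<^esub> KL_w0 \<oplus>\<^bsub>ZS3\<^esub> KL_w0 \<oplus>\<^bsub>ZS3\<^esub> KL_w0 \<oplus>\<^bsub>ZS3\<^esub> KL_w0"
proof -
  note apply_simps = int_group_ring_simps(3,4) S3_one KL_basis_def KL_support_def
  show "\<one>\<^bsub>ZS3\<^esub> = KL_e"
    by (rule ZS3_eqI) (simp_all only: KL_basis_in_ZS3 S3_elements ZS3.one_closed, simp_all add: apply_simps)
qed (rule ZS3_eqI;
    simp only: KL_basis_in_ZS3 ZS3.m_closed ZS3.add.m_closed S3_elements KL_basis_mult_apply;
    simp add: int_group_ring_simps(4) KL_basis_def KL_support_def S3_carrier)+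

lemma KL_semiring_simps:
  "carrier KL_semiring = range KL_comb"
  "mult KL_semiring = mult ZS3" "one KL_semiring = one ZS3"
  "zero KL_semiring = zero ZS3" "add KL_semiring = add ZS3"
  by (simp_all add: KL_semiring_def)

lemma KL_comb_outside: "z \<notin> carrier S3 \<Longrightarrow> KL_comb c z = 0"
  by (auto simp: KL_comb_def KL_basis_def KL_support_def S3_carrier)

lemma KL_comb_apply:
  "KL_comb c longest_w0 = int (c longest_w0)"
  "KL_comb c (refl_s \<circ> refl_t) = int (c (refl_s \<circ> refl_t) + c longest_w0)"
  "KL_comb c (refl_t \<circ> refl_s) = int (c (refl_t \<circ> refl_s) + c longest_w0)"
  "KL_comb c refl_s = int (c refl_s + c (refl_s \<circ> refl_t) + c (refl_t \<circ> refl_s) + c longest_w0)"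
  "KL_comb c refl_t = int (c refl_t + c (refl_s \<circ> refl_t) + c (refl_t \<circ> refl_s) + c longest_w0)"
  "KL_comb c id = int (c id + c refl_s + c refl_t + c (refl_s \<circ> refl_t)
     + c (refl_t \<circ> refl_s) + c longest_w0)"
  by (simp_all add: KL_comb_def KL_basis_def KL_support_def S3_carrier)

text \<open>The basis is unitriangular for the Bruhat order: reading off the values of a combination from
  the longest element downwards recovers its coefficients one at a time.\<close>

lemma KL_comb_eq_iff: "KL_comb c = KL_comb d \<longleftrightarrow> (\<forall>w\<in>carrier S3. c w = d w)"
proof
  assume "KL_comb c = KL_comb d"
  then have eq: "KL_comb c w = KL_comb d w" for w by simp
  show "\<forall>w\<in>carrier S3. c w = d w"
    using eq[of longest_w0] eq[of "refl_s \<circ> refl_t"] eq[of "refl_t \<circ> refl_s"]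
      eq[of refl_s] eq[of refl_t] eq[of id]
    unfolding KL_comb_apply of_nat_eq_iff by (simp add: S3_carrier)
next
  assume "\<forall>w\<in>carrier S3. c w = d w"
  then show "KL_comb c = KL_comb d"
    by (auto simp: KL_comb_def intro!: ext sum.cong)
qed

lemma KL_coeff_comb: "KL_coeff (KL_comb c) = (\<lambda>w. if w \<in> carrier S3 then c w else 0)"
  unfolding KL_coeff_def
proof (rule the_equality)
  fix d assume d: "(\<forall>w. w \<notin> carrier S3 \<longrightarrow> d w = 0) \<and> KL_comb d = KL_comb c"
  then show "d = (\<lambda>w. if w \<in> carrier S3 then c w else 0)"
    by (auto simp: KL_comb_eq_iff intro!: ext)
qed (simp add: KL_comb_eq_iff)

lemma KL_comb_add: "KL_comb c \<oplus>\<^bsub>ZS3\<^esub> KL_comb d = KL_comb (\<lambda>w. c w + d w)"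
  by (simp add: int_group_ring_simps(4) KL_comb_def fun_eq_iff sum.distrib distrib_right)

lemma KL_comb_zero: "\<zero>\<^bsub>ZS3\<^esub> = KL_comb (\<lambda>w. 0)"
  by (simp add: int_group_ring_simps(2) KL_comb_def)

lemma KL_comb_single:
  assumes "w \<in> carrier S3"
  shows "KL_basis w = KL_comb (\<lambda>v. if v = w then 1 else 0)"
proof
  fix z
  have "(\<Sum>v\<in>carrier S3. int (if v = w then 1 else 0) * KL_basis v z)
      = (\<Sum>v\<in>carrier S3. if v = w then KL_basis w z else 0)"
    by (rule sum.cong) auto
  then show "KL_basis w z = KL_comb (\<lambda>v. if v = w then 1 else 0) z"
    using assms S3_finite by (simp add: KL_comb_def)
qed

lemma KL_semiring_subset: "r \<in> carrier KL_semiring \<Longrightarrow> r \<in> carrier ZS3"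
  by (auto simp: KL_semiring_simps ZS3_carrier KL_comb_outside)

lemma KL_add_closed:
  "r \<in> carrier KL_semiring \<Longrightarrow> q \<in> carrier KL_semiring \<Longrightarrow> r \<oplus>\<^bsub>KL_semiring\<^esub> q \<in> carrier KL_semiring"
  by (auto simp: KL_semiring_simps KL_comb_add)

lemma KL_zero_closed: "\<zero>\<^bsub>KL_semiring\<^esub> \<in> carrier KL_semiring"
  by (simp add: KL_semiring_simps KL_comb_zero)

lemma KL_basis_closed [simp]: "w \<in> carrier S3 \<Longrightarrow> KL_basis w \<in> carrier KL_semiring"
  by (simp add: KL_semiring_simps KL_comb_single)

text \<open>The semiring is generated by the six basis elements as an additive monoid. Hence every property
  that is preserved by sums, such as compatibility of an additive map with the action, need only be
  checked on the basis.\<close>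

lemma KL_semiring_induct [consumes 1, case_names zero basis add]:
  assumes "r \<in> carrier KL_semiring"
    and zero: "P \<zero>\<^bsub>KL_semiring\<^esub>"
    and basis: "\<And>w. w \<in> carrier S3 \<Longrightarrow> P (KL_basis w)"
    and add: "\<And>r q. r \<in> carrier KL_semiring \<Longrightarrow> q \<in> carrier KL_semiring \<Longrightarrow> P r \<Longrightarrow> P q
      \<Longrightarrow> P (r \<oplus>\<^bsub>KL_semiring\<^esub> q)"
  shows "P r"
proof -
  have "P (KL_comb c)" for c
  proof (induction "\<Sum>w\<in>carrier S3. c w" arbitrary: c)
    case 0
    then have "KL_comb c = \<zero>\<^bsub>KL_semiring\<^esub>"
      using S3_finite by (simp add: KL_semiring_simps KL_comb_zero KL_comb_eq_iff)
    then show ?case using zero by simp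
  next
    case (Suc n)
    then obtain w where w: "w \<in> carrier S3" "c w \<noteq> 0"
      by (metis Zero_not_Suc sum.neutral)
    let ?d = "c(w := c w - 1)"
    have sum: "KL_comb c = KL_basis w \<oplus>\<^bsub>KL_semiring\<^esub> KL_comb ?d"
      using w by (simp add: KL_semiring_simps KL_comb_single KL_comb_add KL_comb_eq_iff)
    have "(\<Sum>v\<in>carrier S3. c v) = Suc (\<Sum>v\<in>carrier S3. ?d v)"
      using w S3_finite by (simp add: sum.remove[of "carrier S3" w])
    with Suc have "P (KL_comb ?d)" by (metis Suc_inject)
    moreover have "KL_comb ?d \<in> carrier KL_semiring"
      by (simp add: KL_semiring_simps(1))
    ultimately show ?case
      unfolding sum using w(1) by (intro add basis KL_basis_closed)
  qed
  then show ?thesis using assms(1) by (auto simp: KL_semiring_simps(1))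
qed

lemmas KL_table = KL_multiplication_table[folded KL_semiring_simps]

lemma KL_one_closed: "\<one>\<^bsub>KL_semiring\<^esub> \<in> carrier KL_semiring"
  by (simp add: KL_table(1))

text \<open>The left factor is reduced to the elements \<open>KL_s\<close>, \<open>KL_t\<close>, \<open>KL_w0\<close>, which generate the semiring
  as a semiring. The third is indispensable: the equation \<open>KL_s KL_ts = KL_w0 + KL_s\<close> cannot be solved
  for \<open>KL_w0\<close> without subtraction.\<close>

lemma KL_mult_closed:
  assumes "r \<in> carrier KL_semiring" "q \<in> carrier KL_semiring"
  shows "r \<otimes>\<^bsub>KL_semiring\<^esub> q \<in> carrier KL_semiring"
proof -
  let ?R = KL_semiring
  note sub = KL_semiring_subset
  have assoc: "x \<otimes>\<^bsub>?R\<^esub> y \<otimes>\<^bsub>?R\<^esub> z = x \<otimes>\<^bsub>?R\<^esub> (y \<otimes>\<^bsub>?R\<^esub> z)"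
    if "x \<in> carrier ?R" "y \<in> carrier ?R" "z \<in> carrier ?R" for x y z
    using that by (simp add: KL_semiring_simps(2) ZS3.m_assoc sub)
  have distr: "x \<otimes>\<^bsub>?R\<^esub> (y \<oplus>\<^bsub>?R\<^esub> z) = x \<otimes>\<^bsub>?R\<^esub> y \<oplus>\<^bsub>?R\<^esub> x \<otimes>\<^bsub>?R\<^esub> z"
      "(y \<oplus>\<^bsub>?R\<^esub> z) \<otimes>\<^bsub>?R\<^esub> x = y \<otimes>\<^bsub>?R\<^esub> x \<oplus>\<^bsub>?R\<^esub> z \<otimes>\<^bsub>?R\<^esub> x"
    if "x \<in> carrier ?R" "y \<in> carrier ?R" "z \<in> carrier ?R" for x y z
    using that by (simp_all add: KL_semiring_simps(2,5) ZS3.l_distr ZS3.r_distr sub)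
  have null: "x \<otimes>\<^bsub>?R\<^esub> \<zero>\<^bsub>?R\<^esub> = \<zero>\<^bsub>?R\<^esub>" "\<zero>\<^bsub>?R\<^esub> \<otimes>\<^bsub>?R\<^esub> x = \<zero>\<^bsub>?R\<^esub>" if "x \<in> carrier ?R" for x
    using that by (simp_all add: KL_semiring_simps(2,4) sub)
  have one: "x \<otimes>\<^bsub>?R\<^esub> KL_e = x" "KL_e \<otimes>\<^bsub>?R\<^esub> x = x" if "x \<in> carrier ?R" for x
    using that by (simp_all add: sub KL_semiring_simps(2) flip: KL_multiplication_table(1))
  note closed = KL_add_closed KL_zero_closed KL_basis_closed S3_elements
  have w0: "KL_w0 \<otimes>\<^bsub>?R\<^esub> KL_st \<in> carrier ?R" "KL_w0 \<otimes>\<^bsub>?R\<^esub> KL_ts \<in> carrier ?R"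
    by (simp_all add: closed distr assoc[symmetric] KL_table flip: KL_table(3,7))
  have gen: "g \<otimes>\<^bsub>?R\<^esub> q \<in> carrier ?R" if "g \<in> {KL_s, KL_t, KL_w0}" "q \<in> carrier ?R" for g q
    using that(2)
  proof (induction rule: KL_semiring_induct)
    case zero
    then show ?case using that(1) by (auto simp: null(1) closed)
  next
    case (basis w)
    then show ?case using that(1) by (auto simp: S3_carrier KL_table one closed w0)
  next
    case (add r q)
    then show ?case using that(1) by (auto simp: distr closed)
  qed
  show ?thesis
    using assms(1)
  proof (induction rule: KL_semiring_induct)
    case zero
    then show ?case using assms(2) by (simp add: null(2) closed)
  next
    case (basis w)
    have "KL_st \<otimes>\<^bsub>?R\<^esub> q = KL_s \<otimes>\<^bsub>?R\<^esub> (KL_t \<otimes>\<^bsub>?R\<^esub> q)" "KL_ts \<otimes>\<^bsub>?R\<^esub> q = KL_t \<otimes>\<^bsub>?R\<^esub> (KL_s \<otimes>\<^bsub>?R\<^esub> q)"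
      using assms(2) by (simp_all add: assoc[symmetric] closed KL_table)
    with basis show ?case using assms(2) gen by (auto simp: S3_carrier one)
  next
    case (add r q)
    then show ?case using assms(2) by (auto simp: distr closed)
  qed
qed

lemma KL_semiring_semiring: "semiring KL_semiring"
  unfolding KL_semiring_def
  using KL_add_closed KL_zero_closed KL_one_closed KL_mult_closed KL_semiring_subset
  by (intro ZS3.subsemiring) (auto simp: KL_semiring_simps)

interpretation KL: semiring KL_semiring
  by (rule KL_semiring_semiring)

section \<open>Idempotent semimodules from an action of the basis\<close>

text \<open>In an idempotent monoid multiplicities disappear, so the multiplication table of the semiring
  becomes the multiplicity-free list of relations assumed here. They are what it takes for prescribed
  endomorphisms, one for each basis element, to extend to an action of the whole semiring.\<close>

locale idempotent_KL_action = comm_monoid A for A :: "'a monoid" (structure) +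
  fixes act :: "(nat \<Rightarrow> nat) \<Rightarrow> 'a \<Rightarrow> 'a"
  assumes idem: "x \<in> carrier A \<Longrightarrow> x \<otimes> x = x"
    and act_closed: "w \<in> carrier S3 \<Longrightarrow> x \<in> carrier A \<Longrightarrow> act w x \<in> carrier A"
    and act_mult: "w \<in> carrier S3 \<Longrightarrow> x \<in> carrier A \<Longrightarrow> y \<in> carrier A
        \<Longrightarrow> act w (x \<otimes> y) = act w x \<otimes> act w y"
    and act_one: "w \<in> carrier S3 \<Longrightarrow> act w \<one> = \<one>"
    and act_id: "x \<in> carrier A \<Longrightarrow> act id x = x"
    and act_st: "x \<in> carrier A \<Longrightarrow> act (refl_s \<circ> refl_t) x = act refl_s (act refl_t x)"
    and act_ts: "x \<in> carrier A \<Longrightarrow> act (refl_t \<circ> refl_s) x = act refl_t (act refl_s x)"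
    and act_ss: "x \<in> carrier A \<Longrightarrow> act refl_s (act refl_s x) = act refl_s x"
    and act_tt: "x \<in> carrier A \<Longrightarrow> act refl_t (act refl_t x) = act refl_t x"
    and act_sts: "x \<in> carrier A
        \<Longrightarrow> act refl_s (act refl_t (act refl_s x)) = act longest_w0 x \<otimes> act refl_s x"
    and act_tst: "x \<in> carrier A
        \<Longrightarrow> act refl_t (act refl_s (act refl_t x)) = act longest_w0 x \<otimes> act refl_t x"
    and act_sw0: "x \<in> carrier A \<Longrightarrow> act refl_s (act longest_w0 x) = act longest_w0 x"
    and act_tw0: "x \<in> carrier A \<Longrightarrow> act refl_t (act longest_w0 x) = act longest_w0 x"
    and act_w0s: "x \<in> carrier A \<Longrightarrow> act longest_w0 (act refl_s x) = act longest_w0 x"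
    and act_w0t: "x \<in> carrier A \<Longrightarrow> act longest_w0 (act refl_t x) = act longest_w0 x"
    and act_w0w0: "x \<in> carrier A \<Longrightarrow> act longest_w0 (act longest_w0 x) = act longest_w0 x"
begin

abbreviation M where "M \<equiv> KL_semimodule A act"

lemma M_simps [simp]:
  "carrier M = carrier A" "\<zero>\<^bsub>M\<^esub> = \<one>" "x \<oplus>\<^bsub>M\<^esub> y = x \<otimes> y"
  by (simp_all add: KL_semimodule_def)

lemma smult_comb:
  assumes "x \<in> carrier A"
  shows "KL_comb c \<odot>\<^bsub>M\<^esub> x = (\<Otimes>w\<in>carrier S3. act w x [^] c w)"
  using assms by (auto simp: KL_semimodule_def KL_coeff_comb act_closed intro!: finprod_cong')

lemma smult_basis:
  assumes "w \<in> carrier S3" "x \<in> carrier A"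
  shows "KL_basis w \<odot>\<^bsub>M\<^esub> x = act w x"
proof -
  have "KL_basis w \<odot>\<^bsub>M\<^esub> x = (\<Otimes>v\<in>carrier S3. if w = v then act v x else \<one>)"
    unfolding KL_comb_single[OF assms(1)] smult_comb[OF assms(2)]
    using assms by (intro finprod_cong') (auto simp: act_closed)
  also have "\<dots> = act w x"
    using assms S3_finite by (intro finprod_singleton) (auto simp: act_closed)
  finally show ?thesis .
qed

lemma smult_closed:
  assumes "r \<in> carrier KL_semiring" "x \<in> carrier A"
  shows "r \<odot>\<^bsub>M\<^esub> x \<in> carrier A"
  using assms by (auto simp: KL_semiring_simps(1) smult_comb act_closed)

lemma add_smult:
  assumes "r \<in> carrier KL_semiring" "q \<in> carrier KL_semiring" "x \<in> carrier A"
  shows "(r \<oplus>\<^bsub>KL_semiring\<^esub> q) \<odot>\<^bsub>M\<^esub> x = (r \<odot>\<^bsub>M\<^esub> x) \<otimes> (q \<odot>\<^bsub>M\<^esub> x)"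
proof -
  obtain c d where rq: "r = KL_comb c" "q = KL_comb d"
    using assms by (auto simp: KL_semiring_simps(1))
  have "(r \<oplus>\<^bsub>KL_semiring\<^esub> q) \<odot>\<^bsub>M\<^esub> x = (\<Otimes>w\<in>carrier S3. act w x [^] c w \<otimes> act w x [^] d w)"
    unfolding rq KL_semiring_simps KL_comb_add smult_comb[OF assms(3)]
    using assms(3) by (intro finprod_cong') (auto simp: act_closed nat_pow_mult)
  also have "\<dots> = (r \<odot>\<^bsub>M\<^esub> x) \<otimes> (q \<odot>\<^bsub>M\<^esub> x)"
    unfolding rq smult_comb[OF assms(3)]
    using assms(3) by (intro finprod_multf) (auto simp: act_closed)
  finally show ?thesis .
qed

lemma zero_smult: "x \<in> carrier A \<Longrightarrow> \<zero>\<^bsub>KL_semiring\<^esub> \<odot>\<^bsub>M\<^esub> x = \<one>"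
  by (simp add: KL_semiring_simps(4) KL_comb_zero smult_comb)

lemma smult_mult:
  assumes "r \<in> carrier KL_semiring" "x \<in> carrier A" "y \<in> carrier A"
  shows "r \<odot>\<^bsub>M\<^esub> (x \<otimes> y) = (r \<odot>\<^bsub>M\<^esub> x) \<otimes> (r \<odot>\<^bsub>M\<^esub> y)"
  using assms(1)
proof (induction rule: KL_semiring_induct)
  case (add r q)
  then show ?case
    using assms by (simp add: add_smult smult_closed m_ac)
qed (use assms in \<open>simp_all add: zero_smult smult_basis act_mult\<close>)

lemma smult_one:
  assumes "r \<in> carrier KL_semiring"
  shows "r \<odot>\<^bsub>M\<^esub> \<one> = \<one>"
  using assms
proof (induction rule: KL_semiring_induct)
  case (add r q)
  then show ?case
    by (simp add: add_smult)
qed (simp_all add: zero_smult smult_basis act_one)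

text \<open>Both sides are additive in \<open>q\<close>, so for \<open>r\<close> among \<open>KL_s\<close>, \<open>KL_t\<close>, \<open>KL_w0\<close> the claim is a finite
  check against the multiplication table. It then passes to the products \<open>KL_st\<close> and \<open>KL_ts\<close> by
  associativity and to all \<open>r\<close> by additivity.\<close>

lemma mult_smult:
  assumes "r \<in> carrier KL_semiring" "q \<in> carrier KL_semiring" "x \<in> carrier A"
  shows "(r \<otimes>\<^bsub>KL_semiring\<^esub> q) \<odot>\<^bsub>M\<^esub> x = r \<odot>\<^bsub>M\<^esub> (q \<odot>\<^bsub>M\<^esub> x)"
proof -
  let ?R = KL_semiring
  note closed = KL_add_closed KL_zero_closed KL_basis_closed S3_elements KL_mult_closed
    smult_closed act_closed
  note acts = act_id act_st act_ts act_ss act_tt act_sts act_tst act_sw0 act_tw0 act_w0s act_w0t act_w0w0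
  have idem': "x \<otimes> (x \<otimes> y) = x \<otimes> y" if "x \<in> carrier A" "y \<in> carrier A" for x y
    using that by (simp add: m_assoc[symmetric] idem)
  have w0: "KL_w0 \<otimes>\<^bsub>?R\<^esub> KL_st = KL_w0 \<oplus>\<^bsub>?R\<^esub> KL_w0 \<oplus>\<^bsub>?R\<^esub> (KL_w0 \<oplus>\<^bsub>?R\<^esub> KL_w0)"
    "KL_w0 \<otimes>\<^bsub>?R\<^esub> KL_ts = KL_w0 \<oplus>\<^bsub>?R\<^esub> KL_w0 \<oplus>\<^bsub>?R\<^esub> (KL_w0 \<oplus>\<^bsub>?R\<^esub> KL_w0)"
    by (simp_all add: KL.l_distr KL.m_assoc[symmetric] KL_table flip: KL_table(3,7))
  have gen: "(g \<otimes>\<^bsub>?R\<^esub> q) \<odot>\<^bsub>M\<^esub> y = g \<odot>\<^bsub>M\<^esub> (q \<odot>\<^bsub>M\<^esub> y)"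
    if "g \<in> {KL_s, KL_t, KL_w0}" "q \<in> carrier ?R" "y \<in> carrier A" for g q y
    using that(2)
  proof (induction rule: KL_semiring_induct)
    case zero
    have "g \<in> carrier ?R" using that(1) by auto
    then show ?case using that(3) by (simp add: zero_smult smult_one)
  next
    case (basis w)
    have e: "h \<otimes>\<^bsub>?R\<^esub> KL_e = h" if "h \<in> carrier ?R" for h
      using that by (simp flip: KL_table(1))
    from basis show ?case using that(1,3)
      by (auto simp: S3_carrier e KL_table w0 add_smult smult_basis closed acts idem idem')
  next
    case (add r q)
    have "g \<in> carrier ?R" using that(1) by auto
    with add show ?case using that(3) by (simp add: KL.r_distr add_smult smult_mult closed)
  qed
  show ?thesis
    using assms(1)
  proof (induction rule: KL_semiring_induct)
    case zero
    then show ?case using assms by (simp add: zero_smult closed)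
  next
    case (basis w)
    have st: "(KL_st \<otimes>\<^bsub>?R\<^esub> q) \<odot>\<^bsub>M\<^esub> x = KL_st \<odot>\<^bsub>M\<^esub> (q \<odot>\<^bsub>M\<^esub> x)"
      using assms gen[of KL_s "KL_t \<otimes>\<^bsub>?R\<^esub> q" x] gen[of KL_t q x]
      by (simp add: KL.m_assoc smult_basis act_st closed flip: KL_table(3))
        (simp add: KL_table smult_basis act_st closed)
    have ts: "(KL_ts \<otimes>\<^bsub>?R\<^esub> q) \<odot>\<^bsub>M\<^esub> x = KL_ts \<odot>\<^bsub>M\<^esub> (q \<odot>\<^bsub>M\<^esub> x)"
      using assms gen[of KL_t "KL_s \<otimes>\<^bsub>?R\<^esub> q" x] gen[of KL_s q x]
      by (simp add: KL.m_assoc smult_basis act_ts closed flip: KL_table(7))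
        (simp add: KL_table smult_basis act_ts closed)
    have e: "KL_e \<otimes>\<^bsub>?R\<^esub> q = q" 
      using assms(2) by (simp flip: KL_table(1))
    from basis assms(2,3) st ts gen show ?case by (auto simp: S3_carrier e smult_basis act_id closed)
  next
    case (add r q')
    then show ?case using assms by (simp add: KL.l_distr add_smult closed)
  qed
qed

lemma semimodule_M: "semimodule KL_semiring M"
proof (intro semimodule.intro semimodule_axioms.intro)
  show "semiring KL_semiring" by (rule KL_semiring_semiring)
  show "abelian_monoid M"
    by (rule abelian_monoidI) (simp_all add: m_ac)
  fix m assume "m \<in> carrier M"
  then show "\<one>\<^bsub>KL_semiring\<^esub> \<odot>\<^bsub>M\<^esub> m = m"
    by (simp add: KL_table(1) smult_basis act_id)
qed (simp_all add: smult_closed smult_mult smult_one add_smult mult_smult zero_smult)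

end

section \<open>Homomorphisms and quotients\<close>

lemma semimodule_homD:
  assumes "h \<in> semimodule_hom R M N"
  shows "m \<in> carrier M \<Longrightarrow> h m \<in> carrier N"
    and "m \<in> carrier M \<Longrightarrow> n \<in> carrier M \<Longrightarrow> h (m \<oplus>\<^bsub>M\<^esub> n) = h m \<oplus>\<^bsub>N\<^esub> h n"
    and "h \<zero>\<^bsub>M\<^esub> = \<zero>\<^bsub>N\<^esub>"
    and "r \<in> carrier R \<Longrightarrow> m \<in> carrier M \<Longrightarrow> h (r \<odot>\<^bsub>M\<^esub> m) = r \<odot>\<^bsub>N\<^esub> h m"
  using assms by (auto simp: semimodule_hom_def hom_def)

lemma semimodule_homI:
  assumes "\<And>m. m \<in> carrier M \<Longrightarrow> h m \<in> carrier N"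
    and "\<And>m n. m \<in> carrier M \<Longrightarrow> n \<in> carrier M \<Longrightarrow> h (m \<oplus>\<^bsub>M\<^esub> n) = h m \<oplus>\<^bsub>N\<^esub> h n"
    and "h \<zero>\<^bsub>M\<^esub> = \<zero>\<^bsub>N\<^esub>"
    and "\<And>r m. r \<in> carrier R \<Longrightarrow> m \<in> carrier M \<Longrightarrow> h (r \<odot>\<^bsub>M\<^esub> m) = r \<odot>\<^bsub>N\<^esub> h m"
  shows "h \<in> semimodule_hom R M N"
  using assms by (simp add: semimodule_hom_def hom_def)

lemma semimodule_iso_sym:
  assumes "semimodule R M" "semimodule_iso R M N"
  shows "semimodule_iso R N M"
proof -
  interpret M: semimodule R M by fact
  obtain h where h: "h \<in> semimodule_hom R M N" and bij: "bij_betw h (carrier M) (carrier N)"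
    using assms(2) by (auto simp: semimodule_iso_def)
  note hD = semimodule_homD[OF h]
  let ?g = "inv_into (carrier M) h"
  have g: "?g n \<in> carrier M" "h (?g n) = n" if "n \<in> carrier N" for n
    using bij that by (auto simp: bij_betw_def inv_into_into f_inv_into_f)
  have gh: "?g (h m) = m" if "m \<in> carrier M" for m
    using bij that by (auto simp: bij_betw_def)
  have "?g \<in> semimodule_hom R N M"
  proof (rule semimodule_homI)
    fix m n assume "m \<in> carrier N" "n \<in> carrier N"
    then show "?g (m \<oplus>\<^bsub>N\<^esub> n) = ?g m \<oplus>\<^bsub>M\<^esub> ?g n"
      using gh[of "?g m \<oplus>\<^bsub>M\<^esub> ?g n"] by (simp add: hD g)
  next
    fix r n assume "r \<in> carrier R" "n \<in> carrier N"
    then show "?g (r \<odot>\<^bsub>N\<^esub> n) = r \<odot>\<^bsub>M\<^esub> ?g n"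
      using gh[of "r \<odot>\<^bsub>M\<^esub> ?g n"] by (simp add: hD g)
  next
    show "?g \<zero>\<^bsub>N\<^esub> = \<zero>\<^bsub>M\<^esub>"
      using gh[of "\<zero>\<^bsub>M\<^esub>"] by (simp add: hD)
  qed (rule g)
  then show ?thesis
    using bij_betw_inv_into[OF bij] by (auto simp: semimodule_iso_def)
qed

definition kernel_cong :: "('a, 'b, 'c) module_scheme \<Rightarrow> ('b \<Rightarrow> 'd) \<Rightarrow> ('b \<times> 'b) set" where
  "kernel_cong M f = {(x, y). x \<in> carrier M \<and> y \<in> carrier M \<and> f x = f y}"

text \<open>The isomorphism sends an element of \<open>N\<close> to its fibre under \<open>f\<close>. It runs from \<open>N\<close> to the
  quotient because this is the direction in which the classification compares a given semimodule with
  the quotients of \<open>M4\<close>.\<close>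

lemma semimodule_first_isomorphism:
  assumes "semimodule R M" and f: "f \<in> semimodule_hom R M N" and onto: "f ` carrier M = carrier N"
  shows "semimodule_iso R N (quot_semimodule M (kernel_cong M f))"
proof -
  interpret M: semimodule R M by fact
  note fD = semimodule_homD[OF f]
  let ?Q = "quot_semimodule M (kernel_cong M f)"
  define fib where "fib n = {x \<in> carrier M. f x = n}" for n
  have cls: "kernel_cong M f `` {x} = fib (f x)" if "x \<in> carrier M" for x
    using that by (auto simp: kernel_cong_def fib_def)
  have ne: "\<exists>x. x \<in> fib n" if "n \<in> carrier N" for n
    using that unfolding onto[symmetric] fib_def by auto
  have mem: "x \<in> fib n \<longleftrightarrow> x \<in> carrier M \<and> f x = n" for x n
    by (simp add: fib_def)
  have carr: "carrier ?Q = fib ` carrier N"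
    using cls by (auto simp: quot_semimodule_def quotient_def onto[symmetric])
  have "fib \<in> semimodule_hom R N ?Q"
  proof (rule semimodule_homI)
    fix m n assume mn: "m \<in> carrier N" "n \<in> carrier N"
    have "fib m \<oplus>\<^bsub>?Q\<^esub> fib n = (\<Union>x\<in>fib m. \<Union>y\<in>fib n. fib (m \<oplus>\<^bsub>N\<^esub> n))"
      by (simp add: quot_semimodule_def) (auto simp: mem cls fD)
    then show "fib (m \<oplus>\<^bsub>N\<^esub> n) = fib m \<oplus>\<^bsub>?Q\<^esub> fib n"
      using ne mn by auto
  next
    fix r n assume rn: "r \<in> carrier R" "n \<in> carrier N"
    have "r \<odot>\<^bsub>?Q\<^esub> fib n = (\<Union>x\<in>fib n. fib (r \<odot>\<^bsub>N\<^esub> n))"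
      using rn by (simp add: quot_semimodule_def) (auto simp: mem cls fD)
    then show "fib (r \<odot>\<^bsub>N\<^esub> n) = r \<odot>\<^bsub>?Q\<^esub> fib n"
      using ne rn by auto
  next
    show "fib \<zero>\<^bsub>N\<^esub> = \<zero>\<^bsub>?Q\<^esub>"
      by (simp add: quot_semimodule_def cls fD)
  qed (simp add: carr)
  moreover have "bij_betw fib (carrier N) (carrier ?Q)"
  proof (rule bij_betwI')
    fix m n assume "m \<in> carrier N" "n \<in> carrier N"
    then show "fib m = fib n \<longleftrightarrow> m = n"
      using ne mem by metis
  qed (auto simp: carr)
  ultimately show ?thesis by (auto simp: semimodule_iso_def)
qed

context
  fixes R :: "('a, 'r) ring_scheme" and M :: "('a, 'b, 'c) module_scheme" and \<theta>
  assumes M: "semimodule R M" and cong: "semimodule_cong R M \<theta>"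
begin

interpretation M: semimodule R M by (rule M)

lemma cong_equiv: "equiv (carrier M) \<theta>"
  using cong by (simp add: semimodule_cong_def)

lemma cong_translate: "(a, b) \<in> \<theta> \<Longrightarrow> k \<in> carrier M \<Longrightarrow> (a \<oplus>\<^bsub>M\<^esub> k, b \<oplus>\<^bsub>M\<^esub> k) \<in> \<theta>"
  and cong_smult: "(a, b) \<in> \<theta> \<Longrightarrow> r \<in> carrier R \<Longrightarrow> (r \<odot>\<^bsub>M\<^esub> a, r \<odot>\<^bsub>M\<^esub> b) \<in> \<theta>"
  using cong unfolding semimodule_cong_def by blast+

text \<open>The definition of a congruence only translates a related pair by a common element; changing the
  two summands one after the other gives full compatibility with addition.\<close>

lemma cong_add:
  assumes "(a, b) \<in> \<theta>" "(c, d) \<in> \<theta>"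
  shows "(a \<oplus>\<^bsub>M\<^esub> c, b \<oplus>\<^bsub>M\<^esub> d) \<in> \<theta>"
proof -
  have carr: "a \<in> carrier M" "b \<in> carrier M" "c \<in> carrier M" "d \<in> carrier M"
    using assms equiv_type[OF cong_equiv] by auto
  have "(a \<oplus>\<^bsub>M\<^esub> c, b \<oplus>\<^bsub>M\<^esub> c) \<in> \<theta>" "(c \<oplus>\<^bsub>M\<^esub> b, d \<oplus>\<^bsub>M\<^esub> b) \<in> \<theta>"
    using assms carr by (simp_all add: cong_translate)
  then have "(a \<oplus>\<^bsub>M\<^esub> c, b \<oplus>\<^bsub>M\<^esub> c) \<in> \<theta>" "(b \<oplus>\<^bsub>M\<^esub> c, b \<oplus>\<^bsub>M\<^esub> d) \<in> \<theta>"
    using carr by (simp_all add: M.M.a_comm)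
  moreover have "trans \<theta>"
    using cong_equiv by (rule equivE)
  ultimately show ?thesis
    by (blast dest: transD)
qed

lemma quot_simps:
  "carrier (quot_semimodule M \<theta>) = carrier M // \<theta>"
  "\<zero>\<^bsub>quot_semimodule M \<theta>\<^esub> = \<theta> `` {\<zero>\<^bsub>M\<^esub>}"
  by (simp_all add: quot_semimodule_def)

lemma class_add:
  assumes "a \<in> carrier M" "b \<in> carrier M"
  shows "\<theta> `` {a} \<oplus>\<^bsub>quot_semimodule M \<theta>\<^esub> \<theta> `` {b} = \<theta> `` {a \<oplus>\<^bsub>M\<^esub> b}"
proof -
  have "\<theta> `` {x \<oplus>\<^bsub>M\<^esub> y} = \<theta> `` {a \<oplus>\<^bsub>M\<^esub> b}" if "x \<in> \<theta> `` {a}" "y \<in> \<theta> `` {b}" for x y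
    using equiv_class_eq[OF cong_equiv cong_add[of a x b y]] that by auto
  then have "(\<Union>x \<in> \<theta> `` {a}. \<Union>y \<in> \<theta> `` {b}. \<theta> `` {x \<oplus>\<^bsub>M\<^esub> y})
      = (\<Union>x \<in> \<theta> `` {a}. \<Union>y \<in> \<theta> `` {b}. \<theta> `` {a \<oplus>\<^bsub>M\<^esub> b})"
    by (intro SUP_cong refl)
  moreover have "a \<in> \<theta> `` {a}" "b \<in> \<theta> `` {b}"
    using assms equiv_class_self[OF cong_equiv] by auto
  ultimately show ?thesis
    by (simp only: quot_semimodule_def) auto
qed

lemma class_smult:
  assumes "r \<in> carrier R" "a \<in> carrier M"
  shows "r \<odot>\<^bsub>quot_semimodule M \<theta>\<^esub> \<theta> `` {a} = \<theta> `` {r \<odot>\<^bsub>M\<^esub> a}"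
proof -
  have "\<theta> `` {r \<odot>\<^bsub>M\<^esub> x} = \<theta> `` {r \<odot>\<^bsub>M\<^esub> a}" if "x \<in> \<theta> `` {a}" for x
    using equiv_class_eq[OF cong_equiv cong_smult[of a x r]] that assms(1) by auto
  then have "(\<Union>x \<in> \<theta> `` {a}. \<theta> `` {r \<odot>\<^bsub>M\<^esub> x}) = (\<Union>x \<in> \<theta> `` {a}. \<theta> `` {r \<odot>\<^bsub>M\<^esub> a})"
    by (intro SUP_cong refl)
  moreover have "a \<in> \<theta> `` {a}"
    using assms equiv_class_self[OF cong_equiv] by auto
  ultimately show ?thesis
    by (simp only: quot_semimodule_def) auto
qed

lemma class_closed: "a \<in> carrier M \<Longrightarrow> \<theta> `` {a} \<in> carrier (quot_semimodule M \<theta>)"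
  by (simp add: quot_simps quotientI)

lemma class_cases:
  assumes "X \<in> carrier (quot_semimodule M \<theta>)"
  obtains a where "a \<in> carrier M" "X = \<theta> `` {a}"
  using assms by (auto simp: quot_simps elim: quotientE)

lemma class_eq_iff:
  "a \<in> carrier M \<Longrightarrow> b \<in> carrier M \<Longrightarrow> \<theta> `` {a} = \<theta> `` {b} \<longleftrightarrow> (a, b) \<in> \<theta>"
  by (rule eq_equiv_class_iff[OF cong_equiv])

lemma quot_ball:
  "(\<forall>X\<in>carrier (quot_semimodule M \<theta>). P X) \<longleftrightarrow> (\<forall>a\<in>carrier M. P (\<theta> `` {a}))"
  by (auto simp: quot_simps quotient_def)

lemma quot_semimodule: "semimodule R (quot_semimodule M \<theta>)"
proof (intro semimodule.intro semimodule_axioms.intro)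
  let ?Q = "quot_semimodule M \<theta>"
  show "semiring R" ..
  have add: "\<forall>X\<in>carrier ?Q. \<zero>\<^bsub>?Q\<^esub> \<oplus>\<^bsub>?Q\<^esub> X = X"
    "\<forall>X\<in>carrier ?Q. \<forall>Y\<in>carrier ?Q. X \<oplus>\<^bsub>?Q\<^esub> Y \<in> carrier ?Q"
    "\<forall>X\<in>carrier ?Q. \<forall>Y\<in>carrier ?Q. X \<oplus>\<^bsub>?Q\<^esub> Y = Y \<oplus>\<^bsub>?Q\<^esub> X"
    "\<forall>X\<in>carrier ?Q. \<forall>Y\<in>carrier ?Q. \<forall>Z\<in>carrier ?Q. X \<oplus>\<^bsub>?Q\<^esub> Y \<oplus>\<^bsub>?Q\<^esub> Z = X \<oplus>\<^bsub>?Q\<^esub> (Y \<oplus>\<^bsub>?Q\<^esub> Z)"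
    unfolding quot_ball by (simp_all add: quot_simps(2) class_add class_closed M.M.a_ac)
  have zero: "\<zero>\<^bsub>?Q\<^esub> \<in> carrier ?Q"
    by (simp add: quot_simps(2) class_closed)
  show "abelian_monoid ?Q"
    by (rule abelian_monoidI) (rule zero add[rule_format]; assumption)+
  have smult: "\<forall>X\<in>carrier ?Q. r \<odot>\<^bsub>?Q\<^esub> X \<in> carrier ?Q"
    "\<forall>X\<in>carrier ?Q. \<forall>Y\<in>carrier ?Q. r \<odot>\<^bsub>?Q\<^esub> (X \<oplus>\<^bsub>?Q\<^esub> Y) = r \<odot>\<^bsub>?Q\<^esub> X \<oplus>\<^bsub>?Q\<^esub> r \<odot>\<^bsub>?Q\<^esub> Y"
    "r \<odot>\<^bsub>?Q\<^esub> \<zero>\<^bsub>?Q\<^esub> = \<zero>\<^bsub>?Q\<^esub>"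
    if "r \<in> carrier R" for r
    unfolding quot_ball using that
    by (simp_all add: quot_simps(2) class_add class_smult class_closed M.smult_add M.smult_zero)
  show "r \<odot>\<^bsub>?Q\<^esub> X \<in> carrier ?Q" if "r \<in> carrier R" "X \<in> carrier ?Q" for r X
    using smult(1) that by blast
  show "r \<odot>\<^bsub>?Q\<^esub> (X \<oplus>\<^bsub>?Q\<^esub> Y) = r \<odot>\<^bsub>?Q\<^esub> X \<oplus>\<^bsub>?Q\<^esub> r \<odot>\<^bsub>?Q\<^esub> Y"
    if "r \<in> carrier R" "X \<in> carrier ?Q" "Y \<in> carrier ?Q" for r X Y
    using smult(2) that by blast
  show "r \<odot>\<^bsub>?Q\<^esub> \<zero>\<^bsub>?Q\<^esub> = \<zero>\<^bsub>?Q\<^esub>" if "r \<in> carrier R" for r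
    using smult(3) that by blast
  have ring: "\<forall>X\<in>carrier ?Q. (r \<oplus>\<^bsub>R\<^esub> q) \<odot>\<^bsub>?Q\<^esub> X = r \<odot>\<^bsub>?Q\<^esub> X \<oplus>\<^bsub>?Q\<^esub> q \<odot>\<^bsub>?Q\<^esub> X"
    "\<forall>X\<in>carrier ?Q. (r \<otimes>\<^bsub>R\<^esub> q) \<odot>\<^bsub>?Q\<^esub> X = r \<odot>\<^bsub>?Q\<^esub> (q \<odot>\<^bsub>?Q\<^esub> X)"
    if "r \<in> carrier R" "q \<in> carrier R" for r q
    unfolding quot_ball using that
    by (simp_all add: quot_simps(2) class_add class_smult M.add_smult M.mult_smult)
  fix r q X assume "r \<in> carrier R" "q \<in> carrier R" "X \<in> carrier ?Q"
  then show "(r \<oplus>\<^bsub>R\<^esub> q) \<odot>\<^bsub>?Q\<^esub> X = r \<odot>\<^bsub>?Q\<^esub> X \<oplus>\<^bsub>?Q\<^esub> q \<odot>\<^bsub>?Q\<^esub> X"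
    "(r \<otimes>\<^bsub>R\<^esub> q) \<odot>\<^bsub>?Q\<^esub> X = r \<odot>\<^bsub>?Q\<^esub> (q \<odot>\<^bsub>?Q\<^esub> X)"
    using ring(1,2) by blast+
next
  let ?Q = "quot_semimodule M \<theta>"
  fix X assume "X \<in> carrier ?Q"
  then obtain a where "a \<in> carrier M" "X = \<theta> `` {a}" by (rule class_cases)
  then show "\<zero>\<^bsub>R\<^esub> \<odot>\<^bsub>?Q\<^esub> X = \<zero>\<^bsub>?Q\<^esub>" "\<one>\<^bsub>R\<^esub> \<odot>\<^bsub>?Q\<^esub> X = X"
    by (simp_all add: quot_simps(2) class_smult M.zero_smult M.one_smult)
qed

text \<open>The preimage in \<open>M\<close> of a subsemimodule of the quotient is a subsemimodule, hence \<open>{0}\<close> or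
  \<open>M\<close>. The element \<open>m\<close> witnesses that the quotient is not zero.\<close>

lemma quot_minimal:
  assumes min: "minimal_semimodule R M" and m: "m \<in> carrier M" "(m, \<zero>\<^bsub>M\<^esub>) \<notin> \<theta>"
  shows "minimal_semimodule R (quot_semimodule M \<theta>)"
  unfolding minimal_semimodule_def
proof (intro conjI allI impI)
  let ?Q = "quot_semimodule M \<theta>"
  show "semimodule R ?Q" by (rule quot_semimodule)
  have "\<theta> `` {m} \<noteq> \<zero>\<^bsub>?Q\<^esub>"
    using m by (simp add: quot_simps class_eq_iff)
  then show "carrier ?Q \<noteq> {\<zero>\<^bsub>?Q\<^esub>}"
    using class_closed[OF m(1)] by auto
  fix H assume "subsemimodule H R ?Q"
  then interpret H: subsemimodule H R ?Q .
  define K where "K = {x \<in> carrier M. \<theta> `` {x} \<in> H}"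
  have "subsemimodule K R M"
  proof (intro subsemimodule.intro submonoid.intro subsemimodule_axioms.intro)
    fix x y assume "x \<in> K" "y \<in> K"
    then show "x \<otimes>\<^bsub>add_monoid M\<^esub> y \<in> K"
      using H.m_closed[of "\<theta> `` {x}" "\<theta> `` {y}"] by (simp add: K_def class_add)
  next
    fix r x assume "r \<in> carrier R" "x \<in> K"
    then show "r \<odot>\<^bsub>M\<^esub> x \<in> K"
      using H.smult_closed[of r "\<theta> `` {x}"] by (simp add: K_def class_smult)
  qed (use H.one_closed in \<open>auto simp: K_def quot_simps\<close>)
  then have "K = {\<zero>\<^bsub>M\<^esub>} \<or> K = carrier M"
    using min by (simp add: minimal_semimodule_def)
  moreover have "H = (\<lambda>x. \<theta> `` {x}) ` K"
  proof (intro equalityI subsetI)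
    fix X assume "X \<in> H"
    moreover from this obtain a where "a \<in> carrier M" "X = \<theta> `` {a}"
      using H.subset by (auto elim: class_cases)
    ultimately show "X \<in> (\<lambda>x. \<theta> `` {x}) ` K" by (auto simp: K_def)
  qed (auto simp: K_def)
  ultimately show "H = {\<zero>\<^bsub>?Q\<^esub>} \<or> H = carrier ?Q"
    by (auto simp: quot_simps quotient_def)
qed

end

lemma idempotent_not_abelian_group:
  assumes "x \<in> carrier M" "x \<noteq> \<zero>\<^bsub>M\<^esub>" "x \<oplus>\<^bsub>M\<^esub> x = x"
  shows "\<not> abelian_group M"
proof
  assume "abelian_group M"
  then interpret abelian_group M .
  show False
    using assms add.r_cancel_one by auto
qed

section \<open>Minimal proper semimodules\<close>

lemma subsemimoduleI:
  assumes "H \<subseteq> carrier M" "\<zero>\<^bsub>M\<^esub> \<in> H" "\<And>x y. x \<in> H \<Longrightarrow> y \<in> H \<Longrightarrow> x \<oplus>\<^bsub>M\<^esub> y \<in> H"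
    and "\<And>r x. r \<in> carrier R \<Longrightarrow> x \<in> H \<Longrightarrow> r \<odot>\<^bsub>M\<^esub> x \<in> H"
  shows "subsemimodule H R M"
  using assms by (intro subsemimodule.intro submonoid.intro subsemimodule_axioms.intro) auto

text \<open>The four lemmas \<open>conical\<close>, \<open>generated\<close>, \<open>halving\<close> and \<open>idempotent_if_nonzero_idempotent\<close> below
  follow one scheme: a suitable subset is a subsemimodule with a non-zero element, hence everything.
  They hold over every semiring.\<close>

locale minimal_proper_semimodule = semimodule R M
  for R (structure) and M :: "('a, 'b, 'c) module_scheme" (structure) +
  assumes nonzero: "carrier M \<noteq> {\<zero>\<^bsub>M\<^esub>}"
    and minimal: "subsemimodule H R M \<Longrightarrow> H = {\<zero>\<^bsub>M\<^esub>} \<or> H = carrier M"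
    and proper: "\<not> abelian_group M"
begin

lemma subsemimodule_full:
  assumes "subsemimodule H R M" "x \<in> H" "x \<noteq> \<zero>\<^bsub>M\<^esub>"
  shows "H = carrier M"
  using minimal[OF assms(1)] assms(2,3) by auto

lemma obtain_nonzero:
  obtains x where "x \<in> carrier M" "x \<noteq> \<zero>\<^bsub>M\<^esub>"
  using nonzero M.zero_closed by blast

text \<open>The elements with an additive inverse form a subsemimodule. If it were everything, the semimodule
  would be a module.\<close>

lemma conical:
  assumes "x \<in> carrier M" "y \<in> carrier M" "x \<oplus>\<^bsub>M\<^esub> y = \<zero>\<^bsub>M\<^esub>"
  shows "x = \<zero>\<^bsub>M\<^esub>"
proof (rule ccontr)
  assume x: "x \<noteq> \<zero>\<^bsub>M\<^esub>"
  let ?U = "{x \<in> carrier M. \<exists>y\<in>carrier M. x \<oplus>\<^bsub>M\<^esub> y = \<zero>\<^bsub>M\<^esub>}"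
  have "subsemimodule ?U R M"
  proof (rule subsemimoduleI)
    fix a b assume "a \<in> ?U" "b \<in> ?U"
    then obtain a' b' where ab: "a \<in> carrier M" "b \<in> carrier M" "a' \<in> carrier M" "b' \<in> carrier M"
      "a \<oplus>\<^bsub>M\<^esub> a' = \<zero>\<^bsub>M\<^esub>" "b \<oplus>\<^bsub>M\<^esub> b' = \<zero>\<^bsub>M\<^esub>" by blast
    have "(a \<oplus>\<^bsub>M\<^esub> b) \<oplus>\<^bsub>M\<^esub> (a' \<oplus>\<^bsub>M\<^esub> b') = (a \<oplus>\<^bsub>M\<^esub> a') \<oplus>\<^bsub>M\<^esub> (b \<oplus>\<^bsub>M\<^esub> b')"
      using ab(1-4) by (simp add: M.a_ac)
    then show "a \<oplus>\<^bsub>M\<^esub> b \<in> ?U"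
      using ab by (auto intro!: bexI[of _ "a' \<oplus>\<^bsub>M\<^esub> b'"])
  next
    fix r a assume r: "r \<in> carrier R" and "a \<in> ?U"
    then obtain a' where a: "a \<in> carrier M" "a' \<in> carrier M" "a \<oplus>\<^bsub>M\<^esub> a' = \<zero>\<^bsub>M\<^esub>" by blast
    then have "r \<odot>\<^bsub>M\<^esub> a \<oplus>\<^bsub>M\<^esub> r \<odot>\<^bsub>M\<^esub> a' = \<zero>\<^bsub>M\<^esub>"
      using r by (simp add: smult_zero flip: smult_add)
    then show "r \<odot>\<^bsub>M\<^esub> a \<in> ?U"
      using r a by auto
  qed (auto intro!: bexI[of _ "\<zero>\<^bsub>M\<^esub>"])
  then have "?U = carrier M"
    using x assms by (intro subsemimodule_full[of _ x]) auto
  then have "abelian_group M"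
    by (intro abelian_groupI) (auto simp: M.a_ac dest: M.a_comm)
  with proper show False by blast
qed

lemma generated:
  assumes "x \<in> carrier M" "x \<noteq> \<zero>\<^bsub>M\<^esub>" "y \<in> carrier M"
  obtains r where "r \<in> carrier R" "y = r \<odot>\<^bsub>M\<^esub> x"
proof -
  have "subsemimodule ((\<lambda>r. r \<odot>\<^bsub>M\<^esub> x) ` carrier R) R M"
    using assms(1) by (intro subsemimoduleI)
      (auto simp flip: add_smult mult_smult zero_smult intro!: imageI)
  moreover have "x \<in> (\<lambda>r. r \<odot>\<^bsub>M\<^esub> x) ` carrier R"
    using assms(1) by (auto simp: one_smult intro!: image_eqI[of _ _ "\<one>\<^bsub>R\<^esub>"])
  ultimately have "(\<lambda>r. r \<odot>\<^bsub>M\<^esub> x) ` carrier R = carrier M"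
    using assms(2) by (rule subsemimodule_full)
  then show thesis using assms(3) that by blast
qed

text \<open>The doubles form a subsemimodule, which is not zero because \<open>y + y = 0\<close> would force \<open>y = 0\<close>.\<close>

lemma halving:
  assumes "x \<in> carrier M"
  obtains z where "z \<in> carrier M" "x = z \<oplus>\<^bsub>M\<^esub> z"
proof -
  have "subsemimodule ((\<lambda>z. z \<oplus>\<^bsub>M\<^esub> z) ` carrier M) R M"
  proof (rule subsemimoduleI)
    fix a b assume "a \<in> (\<lambda>z. z \<oplus>\<^bsub>M\<^esub> z) ` carrier M" "b \<in> (\<lambda>z. z \<oplus>\<^bsub>M\<^esub> z) ` carrier M"
    then obtain c d where cd: "c \<in> carrier M" "d \<in> carrier M" "a = c \<oplus>\<^bsub>M\<^esub> c" "b = d \<oplus>\<^bsub>M\<^esub> d"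
      by blast
    then have "a \<oplus>\<^bsub>M\<^esub> b = (c \<oplus>\<^bsub>M\<^esub> d) \<oplus>\<^bsub>M\<^esub> (c \<oplus>\<^bsub>M\<^esub> d)"
      by (simp add: M.a_ac)
    then show "a \<oplus>\<^bsub>M\<^esub> b \<in> (\<lambda>z. z \<oplus>\<^bsub>M\<^esub> z) ` carrier M"
      using cd by blast
  next
    fix r a assume "r \<in> carrier R" "a \<in> (\<lambda>z. z \<oplus>\<^bsub>M\<^esub> z) ` carrier M"
    then show "r \<odot>\<^bsub>M\<^esub> a \<in> (\<lambda>z. z \<oplus>\<^bsub>M\<^esub> z) ` carrier M"
      by (auto simp: smult_add)
  qed (auto intro!: image_eqI[of _ _ "\<zero>\<^bsub>M\<^esub>"])
  moreover obtain y where y: "y \<in> carrier M" "y \<noteq> \<zero>\<^bsub>M\<^esub>"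
    by (rule obtain_nonzero)
  moreover have "y \<oplus>\<^bsub>M\<^esub> y \<noteq> \<zero>\<^bsub>M\<^esub>"
    using y conical by blast
  ultimately have "(\<lambda>z. z \<oplus>\<^bsub>M\<^esub> z) ` carrier M = carrier M"
    by (intro subsemimodule_full[of _ "y \<oplus>\<^bsub>M\<^esub> y"]) auto
  then show thesis using assms that by blast
qed

lemma idempotent_if_nonzero_idempotent:
  assumes "v \<in> carrier M" "v \<noteq> \<zero>\<^bsub>M\<^esub>" "v \<oplus>\<^bsub>M\<^esub> v = v" and "x \<in> carrier M"
  shows "x \<oplus>\<^bsub>M\<^esub> x = x"
proof -
  let ?I = "{x \<in> carrier M. x \<oplus>\<^bsub>M\<^esub> x = x}"
  have "subsemimodule ?I R M"
  proof (rule subsemimoduleI)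
    fix a b assume ab: "a \<in> ?I" "b \<in> ?I"
    then have "a \<in> carrier M" "b \<in> carrier M" by auto
    then have "(a \<oplus>\<^bsub>M\<^esub> b) \<oplus>\<^bsub>M\<^esub> (a \<oplus>\<^bsub>M\<^esub> b) = (a \<oplus>\<^bsub>M\<^esub> a) \<oplus>\<^bsub>M\<^esub> (b \<oplus>\<^bsub>M\<^esub> b)"
      by (simp add: M.a_ac)
    then show "a \<oplus>\<^bsub>M\<^esub> b \<in> ?I" using ab by simp
  qed (auto simp flip: smult_add)
  then have "?I = carrier M"
    using assms by (intro subsemimodule_full[of _ v]) auto
  then show ?thesis using assms(4) by blast
qed

text \<open>This is the source of idempotents. Put \<open>x = z + z\<close>, so that \<open>z = x + u\<close> and
  \<open>x = x + (z + u)\<close>: the element \<open>z + u\<close> is absorbed by \<open>x\<close>, and since \<open>z + u = x + u + u\<close> it is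
  absorbed by itself.\<close>

lemma idempotent_if_absorbed_by_half:
  assumes z: "z \<in> carrier M" "z \<noteq> \<zero>\<^bsub>M\<^esub>" and u: "u \<in> carrier M"
    and half: "z = (z \<oplus>\<^bsub>M\<^esub> z) \<oplus>\<^bsub>M\<^esub> u" and "x \<in> carrier M"
  shows "x \<oplus>\<^bsub>M\<^esub> x = x"
proof (rule idempotent_if_nonzero_idempotent)
  show "z \<oplus>\<^bsub>M\<^esub> u \<in> carrier M" using z u by simp
  show "z \<oplus>\<^bsub>M\<^esub> u \<noteq> \<zero>\<^bsub>M\<^esub>" using z u conical by blast
  have "(z \<oplus>\<^bsub>M\<^esub> u) \<oplus>\<^bsub>M\<^esub> (z \<oplus>\<^bsub>M\<^esub> u) = ((z \<oplus>\<^bsub>M\<^esub> z) \<oplus>\<^bsub>M\<^esub> u) \<oplus>\<^bsub>M\<^esub> u"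
    using z(1) u by (simp add: M.a_ac)
  then show "(z \<oplus>\<^bsub>M\<^esub> u) \<oplus>\<^bsub>M\<^esub> (z \<oplus>\<^bsub>M\<^esub> u) = z \<oplus>\<^bsub>M\<^esub> u"
    using half by simp
qed fact

end

lemma minimal_proper_iff_locale:
  "minimal_proper R M \<longleftrightarrow> minimal_proper_semimodule R M"
  by (auto simp: minimal_semimodule_def proper_semimodule_def minimal_proper_semimodule_def
      minimal_proper_semimodule_axioms_def)

section \<open>Maps and congruences over the Kazhdan-Lusztig semiring\<close>

lemma semimodule_hom_KL:
  assumes "semimodule KL_semiring M" "semimodule KL_semiring N"
    and closed: "\<And>m. m \<in> carrier M \<Longrightarrow> h m \<in> carrier N"
    and add: "\<And>m n. m \<in> carrier M \<Longrightarrow> n \<in> carrier M \<Longrightarrow> h (m \<oplus>\<^bsub>M\<^esub> n) = h m \<oplus>\<^bsub>N\<^esub> h n"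
    and zero: "h \<zero>\<^bsub>M\<^esub> = \<zero>\<^bsub>N\<^esub>"
    and basis: "\<And>w m. w \<in> carrier S3 \<Longrightarrow> m \<in> carrier M
      \<Longrightarrow> h (KL_basis w \<odot>\<^bsub>M\<^esub> m) = KL_basis w \<odot>\<^bsub>N\<^esub> h m"
  shows "h \<in> semimodule_hom KL_semiring M N"
proof (rule semimodule_homI[OF closed add zero])
  interpret M: semimodule KL_semiring M by fact
  interpret N: semimodule KL_semiring N by fact
  fix r m assume "r \<in> carrier KL_semiring" and m: "m \<in> carrier M"
  then show "h (r \<odot>\<^bsub>M\<^esub> m) = r \<odot>\<^bsub>N\<^esub> h m"
  proof (induction rule: KL_semiring_induct)
    case (add r q)
    then show ?case by (simp add: M.add_smult N.add_smult assms(4) closed)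
  qed (simp_all add: M.zero_smult N.zero_smult zero basis closed)
qed

lemma semimodule_cong_KL:
  assumes "semimodule KL_semiring M" and equiv: "equiv (carrier M) \<theta>"
    and translate: "\<And>m n k. (m, n) \<in> \<theta> \<Longrightarrow> k \<in> carrier M \<Longrightarrow> (m \<oplus>\<^bsub>M\<^esub> k, n \<oplus>\<^bsub>M\<^esub> k) \<in> \<theta>"
    and basis: "\<And>w m n. w \<in> carrier S3 \<Longrightarrow> (m, n) \<in> \<theta>
      \<Longrightarrow> (KL_basis w \<odot>\<^bsub>M\<^esub> m, KL_basis w \<odot>\<^bsub>M\<^esub> n) \<in> \<theta>"
  shows "semimodule_cong KL_semiring M \<theta>"
proof -
  interpret M: semimodule KL_semiring M by fact
  have smult: "(r \<odot>\<^bsub>M\<^esub> m, r \<odot>\<^bsub>M\<^esub> n) \<in> \<theta>" if "r \<in> carrier KL_semiring" and mn: "(m, n) \<in> \<theta>" for r m n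
    using that(1)
  proof (induction rule: KL_semiring_induct)
    case zero
    have "(\<zero>\<^bsub>M\<^esub>, \<zero>\<^bsub>M\<^esub>) \<in> \<theta>"
      using equiv_class_self[OF equiv M.M.zero_closed] by simp
    then show ?case
      using mn equiv_type[OF equiv] by (auto simp: M.zero_smult)
  next
    case (add r q)
    have carr: "m \<in> carrier M" "n \<in> carrier M"
      using mn equiv_type[OF equiv] by auto
    have "(r \<odot>\<^bsub>M\<^esub> m \<oplus>\<^bsub>M\<^esub> q \<odot>\<^bsub>M\<^esub> m, r \<odot>\<^bsub>M\<^esub> n \<oplus>\<^bsub>M\<^esub> q \<odot>\<^bsub>M\<^esub> m) \<in> \<theta>"
      using add carr by (intro translate) auto
    moreover have "(q \<odot>\<^bsub>M\<^esub> m \<oplus>\<^bsub>M\<^esub> r \<odot>\<^bsub>M\<^esub> n, q \<odot>\<^bsub>M\<^esub> n \<oplus>\<^bsub>M\<^esub> r \<odot>\<^bsub>M\<^esub> n) \<in> \<theta>"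
      using add carr by (intro translate) auto
    moreover have "trans \<theta>"
      using equiv by (rule equivE)
    ultimately show ?case
      using add carr by (auto simp: M.add_smult M.M.a_comm dest: transD)
  qed (use mn basis in auto)
  show ?thesis
    unfolding semimodule_cong_def using equiv translate smult by blast
qed

section \<open>The six semimodules\<close>

lemma Bmon_simps [simp]: "carrier Bmon = UNIV" "x \<otimes>\<^bsub>Bmon\<^esub> y = (x \<or> y)" "\<one>\<^bsub>Bmon\<^esub> = False"
  by (simp_all add: Bmon_def)

lemma Bmon_comm_monoid: "comm_monoid Bmon"
  by (rule comm_monoidI) auto

lemma Bmon2_comm_monoid: "comm_monoid (Bmon \<times>\<times> Bmon)"
  by (rule comm_monoidI) (auto simp: DirProd_def)

abbreviation "act4 \<equiv> (\<lambda>w (m :: bool \<times> bool). if w = id then m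
            else if w = longest_w0 \<or> m = (False, False) then (False, False)
            else if w = refl_s \<or> w = refl_s \<circ> refl_t then (True, False)
            else (False, True))"

interpretation M1: idempotent_KL_action Bmon "\<lambda>w m. m"
  by (intro idempotent_KL_action.intro idempotent_KL_action_axioms.intro Bmon_comm_monoid) auto

interpretation M2: idempotent_KL_action Bmon "\<lambda>w m. if w = id then m else False"
  by (intro idempotent_KL_action.intro idempotent_KL_action_axioms.intro Bmon_comm_monoid) auto

interpretation M3: idempotent_KL_action Bmon "\<lambda>w m. if w = longest_w0 then False else m"
  by (intro idempotent_KL_action.intro idempotent_KL_action_axioms.intro Bmon_comm_monoid) auto

interpretation M4: idempotent_KL_action "Bmon \<times>\<times> Bmon" act4
  by (intro idempotent_KL_action.intro idempotent_KL_action_axioms.intro Bmon2_comm_monoid) (auto simp: DirProd_def)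

lemmas M1_simps [simp] = M1.M_simps[folded M1_def, simplified]
lemmas M2_simps [simp] = M2.M_simps[folded M2_def, simplified]
lemmas M3_simps [simp] = M3.M_simps[folded M3_def, simplified]

lemma M4_simps [simp]:
  "carrier M4 = UNIV" "\<zero>\<^bsub>M4\<^esub> = (False, False)" "(i, j) \<oplus>\<^bsub>M4\<^esub> (k, l) = (i \<or> k, j \<or> l)"
  using M4.M_simps[folded M4_def] by (simp_all add: DirProd_def)

lemmas M1_basis = M1.smult_basis[folded M1_def, simplified]
lemmas M2_basis = M2.smult_basis[folded M2_def, simplified]
lemmas M3_basis = M3.smult_basis[folded M3_def, simplified]

lemma M4_basis: "w \<in> carrier S3 \<Longrightarrow> KL_basis w \<odot>\<^bsub>M4\<^esub> x = act4 w x"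
  using M4.smult_basis[folded M4_def, of w x] by (simp add: DirProd_def)

lemmas M_semimodule [simp] = M1.semimodule_M[folded M1_def] M2.semimodule_M[folded M2_def]
  M3.semimodule_M[folded M3_def] M4.semimodule_M[folded M4_def]

text \<open>A two-element carrier leaves no room for a subsemimodule in between, and the idempotent 1 prevents
  the monoid from being a group.\<close>

lemma Bmon_minimal_proper:
  assumes "idempotent_KL_action Bmon act"
  shows "minimal_proper KL_semiring (KL_semimodule Bmon act)"
proof -
  interpret idempotent_KL_action Bmon act by fact
  have "H = {False} \<or> H = UNIV" if "subsemimodule H KL_semiring M" for H
  proof -
    interpret H: subsemimodule H KL_semiring M by fact
    have "False \<in> H" using H.one_closed by simp
    then show ?thesis by (cases "True \<in> H") (auto, metis (full_types))
  qed
  moreover have "\<not> abelian_group M"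
    by (rule idempotent_not_abelian_group[of True]) auto
  moreover have "(UNIV :: bool set) \<noteq> {False}" by auto
  ultimately show ?thesis
    using semimodule_M by (simp add: minimal_semimodule_def proper_semimodule_def)
qed

lemma M1_minimal_proper: "minimal_proper KL_semiring M1"
  unfolding M1_def by (rule Bmon_minimal_proper) unfold_locales

lemma M2_minimal_proper: "minimal_proper KL_semiring M2"
  unfolding M2_def by (rule Bmon_minimal_proper) unfold_locales

lemma M3_minimal_proper: "minimal_proper KL_semiring M3"
  unfolding M3_def by (rule Bmon_minimal_proper) unfold_locales

text \<open>Any non-zero element is sent to the two atoms by \<open>KL_s\<close> and \<open>KL_t\<close>, and the atoms generate.\<close>

lemma M4_minimal: "minimal_semimodule KL_semiring M4"
  unfolding minimal_semimodule_def
proof (intro conjI allI impI)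
  show "carrier M4 \<noteq> {\<zero>\<^bsub>M4\<^esub>}" by auto
  fix H assume "subsemimodule H KL_semiring M4"
  then interpret H: subsemimodule H KL_semiring M4 .
  have zero: "(False, False) \<in> H" using H.one_closed by simp
  show "H = {\<zero>\<^bsub>M4\<^esub>} \<or> H = carrier M4"
  proof (cases "H = {(False, False)}")
    case False
    then obtain x where x: "x \<in> H" "x \<noteq> (False, False)" using zero by blast
    have s: "(True, False) \<in> H"
      using H.smult_closed[of KL_s x] x by (simp add: M4_basis)
    have t: "(False, True) \<in> H"
      using H.smult_closed[of KL_t x] x by (simp add: M4_basis)
    have "(True, True) \<in> H"
      using H.m_closed[OF s t] by simp
    with s t zero have "y \<in> H" for y
      by (cases y; cases "fst y"; cases "snd y") auto
    then show ?thesis by auto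
  qed simp
qed simp

lemma M4_minimal_proper: "minimal_proper KL_semiring M4"
  using M4_minimal idempotent_not_abelian_group[of "(True, True)" M4]
  by (simp add: proper_semimodule_def)

text \<open>The explicit forms of the congruences defining \<open>M5\<close> and \<open>M6\<close>: apart from the identified pair, all
  classes are singletons.\<close>

definition cong5 :: "((bool \<times> bool) \<times> (bool \<times> bool)) set" where
  "cong5 = {(x, y). x = y \<or> fst x \<and> fst y}"

definition cong6 :: "((bool \<times> bool) \<times> (bool \<times> bool)) set" where
  "cong6 = {(x, y). x = y \<or> snd x \<and> snd y}"

lemma cong5_cong: "semimodule_cong KL_semiring M4 cong5"
proof (rule semimodule_cong_KL)
  show "equiv (carrier M4) cong5"
    by (rule equivI) (auto simp: cong5_def refl_on_def sym_def trans_def)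
qed (auto simp: cong5_def M4_basis)

lemma cong6_cong: "semimodule_cong KL_semiring M4 cong6"
proof (rule semimodule_cong_KL)
  show "equiv (carrier M4) cong6"
    by (rule equivI) (auto simp: cong6_def refl_on_def sym_def trans_def)
qed (auto simp: cong6_def M4_basis)

text \<open>Each of the two congruences above already is the least equivalence relation containing the
  prescribed pair, which is why it can be compared with an arbitrary equivalence relation.\<close>

lemma cong_identifying_eqI:
  assumes "semimodule_cong R M \<theta>" "(a, b) \<in> \<theta>"
    and "\<And>\<eta>. equiv (carrier M) \<eta> \<Longrightarrow> (a, b) \<in> \<eta> \<Longrightarrow> \<theta> \<subseteq> \<eta>"
  shows "cong_identifying R M a b = \<theta>"
  unfolding cong_identifying_def using assms by (auto simp: semimodule_cong_def)

lemma equiv_UNIV_D: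
  assumes "equiv UNIV \<eta>"
  shows "(x, x) \<in> \<eta>" and "(x, y) \<in> \<eta> \<Longrightarrow> (y, x) \<in> \<eta>"
  using assms by (auto simp: equiv_def refl_on_def sym_def)

lemma M5_eq: "M5 = quot_semimodule M4 cong5"
proof -
  have "cong_identifying KL_semiring M4 (True, False) (True, True) = cong5"
  proof (rule cong_identifying_eqI[OF cong5_cong])
    fix \<eta> :: "((bool \<times> bool) \<times> (bool \<times> bool)) set"
    assume "equiv (carrier M4) \<eta>" and ident: "((True, False), (True, True)) \<in> \<eta>"
    then have equiv: "equiv UNIV \<eta>" by simp
    note mem = ident equiv_UNIV_D(2)[OF equiv ident] equiv_UNIV_D(1)[OF equiv]
    have "((i, j), (k, l)) \<in> cong5 \<Longrightarrow> ((i, j), (k, l)) \<in> \<eta>" for i j k l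
      by (cases i; cases j; cases k; cases l) (simp_all add: cong5_def mem)
    then show "cong5 \<subseteq> \<eta>"
      by (simp add: subset_iff)
  qed (simp add: cong5_def)
  then show ?thesis by (simp add: M5_def)
qed

lemma M6_eq: "M6 = quot_semimodule M4 cong6"
proof -
  have "cong_identifying KL_semiring M4 (False, True) (True, True) = cong6"
  proof (rule cong_identifying_eqI[OF cong6_cong])
    fix \<eta> :: "((bool \<times> bool) \<times> (bool \<times> bool)) set"
    assume "equiv (carrier M4) \<eta>" and ident: "((False, True), (True, True)) \<in> \<eta>"
    then have equiv: "equiv UNIV \<eta>" by simp
    note mem = ident equiv_UNIV_D(2)[OF equiv ident] equiv_UNIV_D(1)[OF equiv]
    have "((i, j), (k, l)) \<in> cong6 \<Longrightarrow> ((i, j), (k, l)) \<in> \<eta>" for i j k l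
      by (cases i; cases j; cases k; cases l) (simp_all add: cong6_def mem)
    then show "cong6 \<subseteq> \<eta>"
      by (simp add: subset_iff)
  qed (simp add: cong6_def)
  then show ?thesis by (simp add: M6_def)
qed

lemma M4_quot_minimal_proper:
  assumes cong: "semimodule_cong KL_semiring M4 \<theta>" and ne: "((True, True), (False, False)) \<notin> \<theta>"
  shows "minimal_proper KL_semiring (quot_semimodule M4 \<theta>)"
proof -
  note Q = M_semimodule(4) cong
  let ?Q = "quot_semimodule M4 \<theta>" and ?x = "\<theta> `` {(True, True)}"
  have "?x \<noteq> \<zero>\<^bsub>?Q\<^esub>"
    using ne class_eq_iff[OF Q] by (simp add: quot_simps[OF Q])
  moreover have "?x \<oplus>\<^bsub>?Q\<^esub> ?x = ?x"
    by (simp add: class_add[OF Q])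
  moreover have "?x \<in> carrier ?Q"
    by (simp add: class_closed[OF Q])
  ultimately have "\<not> abelian_group ?Q"
    by (intro idempotent_not_abelian_group)
  then show ?thesis
    using quot_minimal[OF Q M4_minimal, of "(True, True)"] ne quot_semimodule[OF Q]
    by (simp add: proper_semimodule_def)
qed

lemma M5_minimal_proper: "minimal_proper KL_semiring M5"
  unfolding M5_eq by (rule M4_quot_minimal_proper[OF cong5_cong]) (simp add: cong5_def)

lemma M6_minimal_proper: "minimal_proper KL_semiring M6"
  unfolding M6_eq by (rule M4_quot_minimal_proper[OF cong6_cong]) (simp add: cong6_def)

section \<open>The six semimodules are pairwise non-isomorphic\<close>

text \<open>Three properties of the action of a single semiring element, all expressed by equations and
  therefore invariant under isomorphism. In \<open>M5\<close> and \<open>M6\<close> exactly one of the two atoms of \<open>M4\<close> has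
  become the top element, and \<open>inflates\<close> detects which: \<open>KL_s\<close> maps non-zero elements to the first
  atom and \<open>KL_t\<close> to the second.\<close>

definition annihilates where
  "annihilates r M \<longleftrightarrow> (\<forall>m\<in>carrier M. r \<odot>\<^bsub>M\<^esub> m = \<zero>\<^bsub>M\<^esub>)"
definition fixes_all where
  "fixes_all r M \<longleftrightarrow> (\<forall>m\<in>carrier M. r \<odot>\<^bsub>M\<^esub> m = m)"
definition inflates where
  "inflates r M \<longleftrightarrow> (\<forall>m\<in>carrier M. r \<odot>\<^bsub>M\<^esub> m \<oplus>\<^bsub>M\<^esub> m = r \<odot>\<^bsub>M\<^esub> m)"

lemma iso_invariants:
  assumes "semimodule R M" "semimodule_iso R M N" and r: "r \<in> carrier R"
  shows "annihilates r M \<longleftrightarrow> annihilates r N"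
    and "fixes_all r M \<longleftrightarrow> fixes_all r N"
    and "inflates r M \<longleftrightarrow> inflates r N"
proof -
  interpret M: semimodule R M by fact
  obtain h where h: "h \<in> semimodule_hom R M N" and bij: "bij_betw h (carrier M) (carrier N)"
    using assms(2) by (auto simp: semimodule_iso_def)
  note hD = semimodule_homD[OF h]
  have img: "carrier N = h ` carrier M" and inj: "inj_on h (carrier M)"
    using bij by (auto simp: bij_betw_def)
  have eq: "h m = h n \<longleftrightarrow> m = n" if "m \<in> carrier M" "n \<in> carrier M" for m n
    using inj that by (auto simp: inj_on_eq_iff)
  show "annihilates r M \<longleftrightarrow> annihilates r N" "fixes_all r M \<longleftrightarrow> fixes_all r N"
    "inflates r M \<longleftrightarrow> inflates r N"
    using r by (simp_all add: annihilates_def fixes_all_def inflates_def img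
        flip: hD(2-4)) (simp_all add: eq)
qed

lemma M_invariants:
  "\<not> annihilates KL_w0 M1"
  "annihilates KL_w0 M2" "annihilates KL_w0 M3" "annihilates KL_w0 M4"
  "annihilates KL_s M2" "\<not> annihilates KL_s M3" "\<not> annihilates KL_s M4"
  "fixes_all KL_s M3" "\<not> fixes_all KL_s M4"
  "\<not> inflates KL_s M4" "\<not> inflates KL_t M4"
  by (auto simp: annihilates_def fixes_all_def inflates_def M1_basis M2_basis M3_basis M4_basis)

lemma M5_invariants:
  "annihilates KL_w0 M5" "\<not> annihilates KL_s M5" "\<not> fixes_all KL_s M5" "inflates KL_s M5"
proof -
  note Q = M_semimodule(4) cong5_cong
  note simps = annihilates_def fixes_all_def inflates_def M5_eq quot_ball[OF Q] quot_simps(2)[OF Q]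
    class_smult[OF Q] class_add[OF Q] class_eq_iff[OF Q] M4_basis
  show "annihilates KL_w0 M5" "\<not> annihilates KL_s M5" "\<not> fixes_all KL_s M5" "inflates KL_s M5"
    by (simp_all add: simps) (auto simp: cong5_def)
qed

lemma M6_invariants:
  "annihilates KL_w0 M6" "\<not> annihilates KL_s M6" "\<not> fixes_all KL_s M6" "\<not> inflates KL_s M6"
  "inflates KL_t M6"
proof -
  note Q = M_semimodule(4) cong6_cong
  note simps = annihilates_def fixes_all_def inflates_def M6_eq quot_ball[OF Q] quot_simps(2)[OF Q]
    class_smult[OF Q] class_add[OF Q] class_eq_iff[OF Q] M4_basis
  show "annihilates KL_w0 M6" "\<not> annihilates KL_s M6" "\<not> fixes_all KL_s M6" "\<not> inflates KL_s M6"
    "inflates KL_t M6"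
    by (simp_all add: simps) (auto simp: cong6_def)
qed

lemma M_pairwise_not_iso:
  "\<not> KL_iso M1 M2 \<and> \<not> KL_iso M1 M3 \<and> \<not> KL_iso M1 M4 \<and> \<not> KL_iso M1 M5 \<and> \<not> KL_iso M1 M6 \<and>
   \<not> KL_iso M2 M3 \<and> \<not> KL_iso M2 M4 \<and> \<not> KL_iso M2 M5 \<and> \<not> KL_iso M2 M6 \<and>
   \<not> KL_iso M3 M4 \<and> \<not> KL_iso M3 M5 \<and> \<not> KL_iso M3 M6 \<and>
   \<not> KL_iso M4 M5 \<and> \<not> KL_iso M4 M6 \<and>
   \<not> KL_iso M5 M6"
proof -
  have M5: "semimodule KL_semiring M5"
    using M5_minimal_proper by (simp add: proper_semimodule_def)
  note s = KL_basis_closed[OF S3_elements(2)]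
    and t = KL_basis_closed[OF S3_elements(3)]
    and w0 = KL_basis_closed[OF S3_elements(6)]
  note from_M1 = iso_invariants(1)[OF M_semimodule(1) _ w0]
    and from_M2 = iso_invariants(1)[OF M_semimodule(2) _ s]
    and from_M3 = iso_invariants(2)[OF M_semimodule(3) _ s]
    and M4_M5 = iso_invariants(3)[OF M_semimodule(4) _ s, of M5]
    and M4_M6 = iso_invariants(3)[OF M_semimodule(4) _ t, of M6]
    and M5_M6 = iso_invariants(3)[OF M5 _ s, of M6]
  show ?thesis
    using M_invariants M5_invariants M6_invariants
    by (auto dest: from_M1 from_M2 from_M3 M4_M5 M4_M6 M5_M6)
qed

section \<open>Classification\<close>

text \<open>Sending every non-zero element to 1 is additive because the semimodule is conical.\<close>

lemma Bmon_iso: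
  assumes "minimal_proper_semimodule KL_semiring M" and "idempotent_KL_action Bmon act"
    and carr: "carrier M = {\<zero>\<^bsub>M\<^esub>, x}" and x: "x \<noteq> \<zero>\<^bsub>M\<^esub>"
    and basis: "\<And>w. w \<in> carrier S3 \<Longrightarrow> KL_basis w \<odot>\<^bsub>M\<^esub> x = (if act w True then x else \<zero>\<^bsub>M\<^esub>)"
  shows "KL_iso M (KL_semimodule Bmon act)"
proof -
  interpret minimal_proper_semimodule KL_semiring M by fact
  interpret N: idempotent_KL_action Bmon act by fact
  let ?h = "\<lambda>m. m \<noteq> \<zero>\<^bsub>M\<^esub>"
  have mem: "x \<in> carrier M" "\<zero>\<^bsub>M\<^esub> \<in> carrier M" by (simp_all add: carr)
  have "x \<oplus>\<^bsub>M\<^esub> x \<noteq> \<zero>\<^bsub>M\<^esub>"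
    using conical x mem by blast
  moreover have "act w False = False" if "w \<in> carrier S3" for w
    using N.act_one[OF that] by simp
  ultimately have "?h \<in> semimodule_hom KL_semiring M N.M"
    by (intro semimodule_hom_KL[OF semimodule_axioms N.semimodule_M])
      (auto simp: carr x mem basis N.smult_basis smult_zero split: if_splits)
  moreover have "bij_betw ?h (carrier M) (carrier N.M)"
    using x by (auto simp: bij_betw_def carr inj_on_def image_iff)
  ultimately show ?thesis by (auto simp: semimodule_iso_def)
qed

locale KL_minimal_proper = minimal_proper_semimodule KL_semiring M
  for M :: "((nat \<Rightarrow> nat) \<Rightarrow> int, 'b, 'c) module_scheme" (structure)
begin

abbreviation act (infixr "\<cdot>" 75) where "w \<cdot> m \<equiv> KL_basis w \<odot> m"

lemma basis_relations:
  assumes "m \<in> carrier M"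
  shows "id \<cdot> m = m"
    and "(refl_s \<circ> refl_t) \<cdot> m = refl_s \<cdot> refl_t \<cdot> m"
    and "(refl_t \<circ> refl_s) \<cdot> m = refl_t \<cdot> refl_s \<cdot> m"
    and "refl_s \<cdot> refl_s \<cdot> m = refl_s \<cdot> m \<oplus> refl_s \<cdot> m"
    and "refl_t \<cdot> refl_t \<cdot> m = refl_t \<cdot> m \<oplus> refl_t \<cdot> m"
    and "refl_s \<cdot> refl_t \<cdot> refl_s \<cdot> m = longest_w0 \<cdot> m \<oplus> refl_s \<cdot> m"
    and "refl_t \<cdot> refl_s \<cdot> refl_t \<cdot> m = longest_w0 \<cdot> m \<oplus> refl_t \<cdot> m"
    and "refl_s \<cdot> longest_w0 \<cdot> m = longest_w0 \<cdot> m \<oplus> longest_w0 \<cdot> m"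
    and "refl_t \<cdot> longest_w0 \<cdot> m = longest_w0 \<cdot> m \<oplus> longest_w0 \<cdot> m"
    and "longest_w0 \<cdot> longest_w0 \<cdot> m = longest_w0 \<cdot> m \<oplus> longest_w0 \<cdot> m \<oplus> longest_w0 \<cdot> m
      \<oplus> longest_w0 \<cdot> m \<oplus> longest_w0 \<cdot> m \<oplus> longest_w0 \<cdot> m"
  using assms one_smult[OF assms]
  by (simp_all add: KL_table add_smult flip: mult_smult)

lemma generated_induct:
  assumes "x \<in> carrier M" "x \<noteq> \<zero>" and "y \<in> carrier M"
    and "P \<zero>" and "\<And>w. w \<in> carrier S3 \<Longrightarrow> P (w \<cdot> x)"
    and add: "\<And>y z. y \<in> carrier M \<Longrightarrow> z \<in> carrier M \<Longrightarrow> P y \<Longrightarrow> P z \<Longrightarrow> P (y \<oplus> z)"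
  shows "P y"
proof -
  obtain r where "r \<in> carrier KL_semiring" and y: "y = r \<odot> x"
    using generated assms(1-3) by blast
  then have "P (r \<odot> x)"
  proof (induction arbitrary: y rule: KL_semiring_induct)
    case (add r q)
    then show ?case
      using assms(1) by (simp add: add_smult assms(6))
  qed (use assms in \<open>simp_all add: zero_smult\<close>)
  then show ?thesis by (simp add: y)
qed

text \<open>If each basis element sends \<open>x\<close> to 0 or above \<open>x\<close>, then everything generated by \<open>x\<close>, that is every
  non-zero element, lies above \<open>x\<close>. This applies in particular to a half of \<open>x\<close>, which therefore lies
  above its own double.\<close>

lemma idempotent_if_basis_above:
  assumes x: "x \<in> carrier M" "x \<noteq> \<zero>"
    and basis: "\<And>w. w \<in> carrier S3 \<Longrightarrow> w \<cdot> x = \<zero> \<or> (\<exists>u\<in>carrier M. w \<cdot> x = x \<oplus> u)"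
    and y: "y \<in> carrier M"
  shows "y \<oplus> y = y"
proof -
  have above: "y = \<zero> \<or> (\<exists>u\<in>carrier M. y = x \<oplus> u)" if "y \<in> carrier M" for y
  proof (rule generated_induct[OF x that])
    fix y z assume "z \<in> carrier M" and y: "y = \<zero> \<or> (\<exists>u\<in>carrier M. y = x \<oplus> u)"
      and z: "z = \<zero> \<or> (\<exists>u\<in>carrier M. z = x \<oplus> u)"
    show "y \<oplus> z = \<zero> \<or> (\<exists>u\<in>carrier M. y \<oplus> z = x \<oplus> u)"
    proof (cases "y = \<zero>")
      case True
      with z \<open>z \<in> carrier M\<close> show ?thesis by auto
    next
      case False
      then obtain u where "u \<in> carrier M" "y = x \<oplus> u" using y by blast
      then show ?thesis
        using x \<open>z \<in> carrier M\<close> by (auto simp: a_assoc intro!: bexI[of _ "u \<oplus> z"])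
    qed
  qed (use basis in auto)
  obtain z where z: "z \<in> carrier M" "x = z \<oplus> z"
    using halving[OF x(1)] .
  then have "z \<noteq> \<zero>" using x by auto
  then obtain u where "u \<in> carrier M" "z = x \<oplus> u"
    using above z by blast
  then show ?thesis
    using idempotent_if_absorbed_by_half[of z u y] z \<open>z \<noteq> \<zero>\<close> y by auto
qed

lemma carrier_if_basis_stable:
  assumes x: "x \<in> carrier M" "x \<noteq> \<zero>" "x \<oplus> x = x"
    and basis: "\<And>w. w \<in> carrier S3 \<Longrightarrow> w \<cdot> x = \<zero> \<or> w \<cdot> x = x"
  shows "carrier M = {\<zero>, x}"
proof -
  have "y = \<zero> \<or> y = x" if "y \<in> carrier M" for y
    by (rule generated_induct[OF x(1,2) that]) (use basis x in auto)
  then show ?thesis using x by auto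
qed

text \<open>On the image \<open>x\<close> of some \<open>m\<close> under \<open>KL_w0\<close> every basis element acts as a positive integer, the
  number of its summands. So \<open>x\<close> generates a cyclic monoid, which idempotency cuts down to two
  elements.\<close>

lemma classify_w0_nonzero:
  assumes m: "m \<in> carrier M" "longest_w0 \<cdot> m \<noteq> \<zero>"
  shows "KL_iso M M1"
proof -
  define x where "x = longest_w0 \<cdot> m"
  have x: "x \<in> carrier M" "x \<noteq> \<zero>" using m by (simp_all add: x_def)
  note rel = basis_relations[OF x(1)]
  have gen: "refl_s \<cdot> x = x \<oplus> x" "refl_t \<cdot> x = x \<oplus> x" "longest_w0 \<cdot> x = x \<oplus> x \<oplus> x \<oplus> x \<oplus> x \<oplus> x"
    using basis_relations[OF m(1)] by (simp_all add: x_def)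
  have "\<exists>u\<in>carrier M. w \<cdot> x = x \<oplus> u" if "w \<in> carrier S3" for w
  proof -
    have "w \<cdot> x \<in> {x \<oplus> \<zero>, x \<oplus> x, x \<oplus> (x \<oplus> (x \<oplus> x)), x \<oplus> (x \<oplus> (x \<oplus> (x \<oplus> (x \<oplus> x))))}"
      using that x(1) by (auto simp: S3_carrier rel(1-3) gen smult_add a_assoc)
    then show ?thesis using x(1) by blast
  qed
  then have idem: "y \<oplus> y = y" if "y \<in> carrier M" for y
    using idempotent_if_basis_above[OF x _ that] by blast
  have basis: "w \<cdot> x = x" if "w \<in> carrier S3" for w
    using that x(1) by (auto simp: S3_carrier rel(1-3) gen idem)
  then have "carrier M = {\<zero>, x}"
    using x idem by (intro carrier_if_basis_stable) auto
  then show ?thesis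
    unfolding M1_def using x basis
    by (intro Bmon_iso[OF minimal_proper_semimodule_axioms M1.idempotent_KL_action_axioms]) auto
qed

context
  assumes w0: "\<And>m. m \<in> carrier M \<Longrightarrow> longest_w0 \<cdot> m = \<zero>"
begin

text \<open>With \<open>KL_w0\<close> and \<open>KL_s\<close> also \<open>KL_t\<close> acts as zero, because \<open>t s t = w0 + t\<close>.\<close>

lemma classify_s_zero:
  assumes s: "\<And>m. m \<in> carrier M \<Longrightarrow> refl_s \<cdot> m = \<zero>"
  shows "KL_iso M M2"
proof -
  obtain x where x: "x \<in> carrier M" "x \<noteq> \<zero>" by (rule obtain_nonzero)
  have t: "refl_t \<cdot> m = \<zero>" if "m \<in> carrier M" for m
    using basis_relations(7)[OF that] that by (simp add: w0 s smult_zero)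
  have basis: "w \<cdot> x = (if w = id then x else \<zero>)" if "w \<in> carrier S3" for w
    using that x(1) by (auto simp: S3_carrier basis_relations(1-3) s t w0)
  then have "w \<cdot> x = \<zero> \<or> (\<exists>u\<in>carrier M. w \<cdot> x = x \<oplus> u)" if "w \<in> carrier S3" for w
    using that x(1) by (auto intro!: bexI[of _ "\<zero>"])
  then have "x \<oplus> x = x"
    using idempotent_if_basis_above[OF x _ x(1)] by blast
  then have "carrier M = {\<zero>, x}"
    using x basis by (intro carrier_if_basis_stable) auto
  then show ?thesis
    unfolding M2_def using x basis
    by (intro Bmon_iso[OF minimal_proper_semimodule_axioms M2.idempotent_KL_action_axioms]) auto
qed

text \<open>As \<open>KL_w0\<close> acts as zero, \<open>s t s = s\<close> and \<open>t s t = t\<close>. Hence \<open>a = s m\<close> and \<open>b = t a\<close> satisfy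
  \<open>s b = a\<close>, and \<open>M\<close> consists of combinations of these two. Once
  idempotency is known, \<open>M\<close> is the image of \<open>M4\<close> under \<open>g\<close>, which sends the two atoms to \<open>a\<close> and
  \<open>b\<close>. If \<open>a = b\<close>, the result is \<open>M3\<close>; otherwise only \<open>a + b = a\<close> or \<open>a + b = b\<close> can make
  \<open>g\<close> non-injective, and these relations generate the congruences of \<open>M5\<close> and \<open>M6\<close>.\<close>

lemma classify_s_nonzero:
  assumes m: "m \<in> carrier M" "refl_s \<cdot> m \<noteq> \<zero>"
  shows "KL_iso M M3 \<or> KL_iso M M4 \<or> KL_iso M M5 \<or> KL_iso M M6"
proof -
  define a where "a = refl_s \<cdot> m"
  define b where "b = refl_t \<cdot> a"
  have a: "a \<in> carrier M" "a \<noteq> \<zero>" using m by (simp_all add: a_def)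
  have bc: "b \<in> carrier M" using a by (simp add: b_def)
  have s_b: "refl_s \<cdot> b = a"
    using basis_relations(6)[OF m(1)] m by (simp add: a_def b_def w0)
  then have b: "b \<in> carrier M" "b \<noteq> \<zero>"
    using bc a by (auto simp: smult_zero)
  have s_a: "refl_s \<cdot> a = a \<oplus> a"
    using basis_relations(4)[OF m(1)] by (simp add: a_def)
  have t_a: "refl_t \<cdot> a = b" by (simp add: b_def)
  have t_b: "refl_t \<cdot> b = b \<oplus> b"
    using basis_relations(5)[OF a(1)] by (simp add: b_def)
  note basis = basis_relations(1-3)[OF a(1)] basis_relations(1-3)[OF b(1)]
    s_a s_b t_a t_b smult_add w0 a(1) b(1)
  have above: "y = \<zero> \<or> (\<exists>u\<in>carrier M. y = a \<oplus> u \<or> y = b \<oplus> u)" if "y \<in> carrier M" for y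
  proof (rule generated_induct[OF a that])
    fix w assume "w \<in> carrier S3"
    then have "w \<cdot> a \<in> {\<zero>, a \<oplus> \<zero>, a \<oplus> a, b \<oplus> \<zero>, b \<oplus> b}"
      by (auto simp: S3_carrier basis)
    then show "w \<cdot> a = \<zero> \<or> (\<exists>u\<in>carrier M. w \<cdot> a = a \<oplus> u \<or> w \<cdot> a = b \<oplus> u)"
      using a(1) b(1) by blast
  next
    fix y z assume "z \<in> carrier M" and y: "y = \<zero> \<or> (\<exists>u\<in>carrier M. y = a \<oplus> u \<or> y = b \<oplus> u)"
      and z: "z = \<zero> \<or> (\<exists>u\<in>carrier M. z = a \<oplus> u \<or> z = b \<oplus> u)"
    show "y \<oplus> z = \<zero> \<or> (\<exists>u\<in>carrier M. y \<oplus> z = a \<oplus> u \<or> y \<oplus> z = b \<oplus> u)"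
    proof (cases "y = \<zero>")
      case True
      with z \<open>z \<in> carrier M\<close> show ?thesis by auto
    next
      case False
      then obtain u where "u \<in> carrier M" "y = a \<oplus> u \<or> y = b \<oplus> u" using y by blast
      then show ?thesis
        using a b \<open>z \<in> carrier M\<close> by (auto simp: a_assoc intro!: bexI[of _ "u \<oplus> z"])
    qed
  qed simp
  obtain z where z: "z \<in> carrier M" "a = z \<oplus> z"
    using halving[OF a(1)] .
  then have "z \<noteq> \<zero>" using a by auto
  then obtain u where u: "u \<in> carrier M" "z = a \<oplus> u \<or> z = b \<oplus> u"
    using above z by blast
  \<comment> \<open>A half of \<open>a\<close> lies above \<open>a\<close> or above \<open>b\<close>. In the second case its image under \<open>KL_t\<close> is a half
    of \<open>b\<close> that lies above \<open>b\<close>.\<close>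
  have idem: "y \<oplus> y = y" if "y \<in> carrier M" for y
    using u(2)
  proof
    assume "z = a \<oplus> u"
    then show ?thesis
      using idempotent_if_absorbed_by_half[of z u y] z \<open>z \<noteq> \<zero>\<close> u that by auto
  next
    assume zu: "z = b \<oplus> u"
    let ?z = "refl_t \<cdot> z" and ?u = "refl_t \<cdot> u"
    have b_half: "b = ?z \<oplus> ?z"
      using z by (simp add: b_def flip: smult_add)
    have "?z = ?z \<oplus> ?z \<oplus> (b \<oplus> ?u)"
    proof -
      have "?z = b \<oplus> (b \<oplus> ?u)"
        using zu u by (simp add: basis a_assoc)
      then show ?thesis
        unfolding b_half[symmetric] .
    qed
    moreover have "?z \<noteq> \<zero>"
      using b_half b by auto
    ultimately show ?thesis
      using z u b that by (intro idempotent_if_absorbed_by_half[of ?z "b \<oplus> ?u" y]) auto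
  qed
  note ab_idem = idem[OF a(1)] idem[OF b(1)]
  have sum: "a \<oplus> (a \<oplus> b) = a \<oplus> b" "b \<oplus> (a \<oplus> b) = a \<oplus> b" "b \<oplus> a = a \<oplus> b"
    using a b ab_idem by (simp_all add: a_assoc[symmetric]) (simp_all add: a_ac ab_idem)
  have carr: "carrier M = {\<zero>, a, b, a \<oplus> b}"
  proof -
    have "y \<in> {\<zero>, a, b, a \<oplus> b}" if "y \<in> carrier M" for y
    proof (rule generated_induct[OF a that])
      fix w assume "w \<in> carrier S3"
      then show "w \<cdot> a \<in> {\<zero>, a, b, a \<oplus> b}"
        by (auto simp: S3_carrier basis ab_idem)
    next
      fix y z assume "y \<in> {\<zero>, a, b, a \<oplus> b}" "z \<in> {\<zero>, a, b, a \<oplus> b}"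
      then show "y \<oplus> z \<in> {\<zero>, a, b, a \<oplus> b}"
        using a(1) b(1) by (auto simp: sum ab_idem idem a_comm[of "a \<oplus> b"])
    qed simp
    then show ?thesis using a b by auto
  qed
  have sum_ne: "a \<oplus> b \<noteq> \<zero>"
    using conical a b by blast
  show ?thesis
  proof (cases "a = b")
    case True
    then have "carrier M = {\<zero>, a}" using carr ab_idem by auto
    moreover have "w \<cdot> a = (if w = longest_w0 then \<zero> else a)" if "w \<in> carrier S3" for w
      using that True by (auto simp: S3_carrier basis ab_idem)
    ultimately have "KL_iso M M3"
      unfolding M3_def using a
      by (intro Bmon_iso[OF minimal_proper_semimodule_axioms M3.idempotent_KL_action_axioms]) auto
    then show ?thesis ..
  next
    case False
    define g where "g p = (if fst p then a else \<zero>) \<oplus> (if snd p then b else \<zero>)" for p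
    have g_simps: "g (False, False) = \<zero>" "g (True, False) = a" "g (False, True) = b"
      "g (True, True) = a \<oplus> b"
      using a b by (simp_all add: g_def)
    have g_hom: "g \<in> semimodule_hom KL_semiring M4 M"
    proof (rule semimodule_hom_KL[OF _ semimodule_axioms])
      fix p q :: "bool \<times> bool"
      show "g (p \<oplus>\<^bsub>M4\<^esub> q) = g p \<oplus> g q"
        using a(1) b(1) ab_idem
        by (cases p; cases q) (auto simp: g_def a_ac sum)
      fix w assume "w \<in> carrier S3"
      then show "g (KL_basis w \<odot>\<^bsub>M4\<^esub> p) = KL_basis w \<odot> g p"
        by (cases p; cases "fst p"; cases "snd p")
          (auto simp: S3_carrier M4_basis g_simps basis smult_zero ab_idem)
    qed (use a b in \<open>auto simp: g_def\<close>)
    have g_onto: "g ` carrier M4 = carrier M"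
    proof -
      have "{g (False, False), g (True, False), g (False, True), g (True, True)} \<subseteq> range g"
        by blast
      then show ?thesis
        using semimodule_homD(1)[OF g_hom] by (auto simp: carr g_simps)
    qed
    have first_iso: "KL_iso M (quot_semimodule M4 (kernel_cong M4 g))"
      by (rule semimodule_first_isomorphism[OF M_semimodule(4) g_hom g_onto])
    have kernel: "((i, j), (k, l)) \<in> kernel_cong M4 g \<longleftrightarrow> g (i, j) = g (k, l)" for i j k l
      by (simp add: kernel_cong_def)
    consider "a \<oplus> b = a" | "a \<oplus> b = b" | "a \<oplus> b \<noteq> a" "a \<oplus> b \<noteq> b" by blast
    then show ?thesis
    proof cases
      case 1
      have "((i, j), (k, l)) \<in> kernel_cong M4 g \<longleftrightarrow> ((i, j), (k, l)) \<in> cong5" for i j k l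
        unfolding kernel using a(2) b(2) False 1
        by (cases i; cases j; cases k; cases l) (auto simp: g_simps cong5_def)
      then have "kernel_cong M4 g = cong5" by auto
      then show ?thesis using first_iso by (simp add: M5_eq)
    next
      case 2
      have "((i, j), (k, l)) \<in> kernel_cong M4 g \<longleftrightarrow> ((i, j), (k, l)) \<in> cong6" for i j k l
        unfolding kernel using a(2) b(2) False 2
        by (cases i; cases j; cases k; cases l) (auto simp: g_simps cong6_def)
      then have "kernel_cong M4 g = cong6" by auto
      then show ?thesis using first_iso by (simp add: M6_eq)
    next
      case 3
      have "g (i, j) = g (k, l) \<Longrightarrow> (i, j) = (k, l)" for i j k l
        using a(2) b(2) False 3 sum_ne
        by (cases i; cases j; cases k; cases l) (auto simp: g_simps)
      then have "inj g" by (auto intro!: injI)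
      then have "bij_betw g (carrier M4) (carrier M)"
        using g_onto by (auto simp: bij_betw_def)
      then have "KL_iso M4 M"
        using g_hom by (auto simp: semimodule_iso_def)
      then have "KL_iso M M4" by (rule semimodule_iso_sym[OF M_semimodule(4)])
      then show ?thesis by blast
    qed
  qed
qed

end

lemma classification:
  "KL_iso M M1 \<or> KL_iso M M2 \<or> KL_iso M M3 \<or> KL_iso M M4 \<or> KL_iso M M5 \<or> KL_iso M M6"
  using classify_w0_nonzero classify_s_zero classify_s_nonzero by blast

end

theorem theorem8p3:
  shows
    "minimal_proper KL_semiring M1 \<and> minimal_proper KL_semiring M2 \<and>
     minimal_proper KL_semiring M3 \<and> minimal_proper KL_semiring M4 \<and>
     minimal_proper KL_semiring M5 \<and> minimal_proper KL_semiring M6 \<and>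
     \<not> KL_iso M1 M2 \<and> \<not> KL_iso M1 M3 \<and> \<not> KL_iso M1 M4 \<and> \<not> KL_iso M1 M5 \<and> \<not> KL_iso M1 M6 \<and>
     \<not> KL_iso M2 M3 \<and> \<not> KL_iso M2 M4 \<and> \<not> KL_iso M2 M5 \<and> \<not> KL_iso M2 M6 \<and>
     \<not> KL_iso M3 M4 \<and> \<not> KL_iso M3 M5 \<and> \<not> KL_iso M3 M6 \<and>
     \<not> KL_iso M4 M5 \<and> \<not> KL_iso M4 M6 \<and>
     \<not> KL_iso M5 M6 \<and>
     (\<forall>M :: ((nat \<Rightarrow> nat) \<Rightarrow> int, 'm) module. minimal_proper KL_semiring M \<longrightarrow>
        KL_iso M M1 \<or> KL_iso M M2 \<or> KL_iso M M3 \<or> KL_iso M M4 \<or> KL_iso M M5 \<or> KL_iso M M6)"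
proof -
  have "KL_iso M M1 \<or> KL_iso M M2 \<or> KL_iso M M3 \<or> KL_iso M M4 \<or> KL_iso M M5 \<or> KL_iso M M6"
    if "minimal_proper KL_semiring M" for M :: "((nat \<Rightarrow> nat) \<Rightarrow> int, 'm) module"
    using that unfolding minimal_proper_iff_locale
    by (intro KL_minimal_proper.classification KL_minimal_proper.intro)
  then show ?thesis
    using M1_minimal_proper M2_minimal_proper M3_minimal_proper M4_minimal_proper
      M5_minimal_proper M6_minimal_proper M_pairwise_not_iso
    by blast
qed

end
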